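(* Let $X$ be a locally compact space equipped with a ($\sigma$-finite) Radon measure with full support. Let $M_\varphi \colon B(L^2(X)) \to B(L^2(X))$ be a positive measurable Schur multiplier whose symbol $\varphi \colon X \times X \to \mathbb{C}$ is a continuous function. Then there exist a Hilbert space $H$ and a bounded continuous map $\alpha \colon X \to H$, $x\mapsto \alpha_x$ (where $H$ carries its norm topology), such that $$\varphi(x,y)=\langle \alpha_x,\alpha_y\rangle_H,\qquad x,y\in X.$$
   Context: All measure spaces are assumed complete. $S^2_X$ and $S^\infty_X$ denote the Hilbert-Schmidt and compact operators on the complex Hilbert space $L^2(X)$. For $f\in L^2(X\times X)$, $K_f\in S^2_X$ is the operator $(K_f\xi)(x)=\int_X f(x,y)\xi(y)\,dy$. A function $\varphi\in L^\infty(X\times X)$ induces a measurable Schur multiplier if $K_f\mapsto K_{\varphi f}$ ($f\in L^2(X\times X)$) induces a bounded operator $S^\infty_X\to B(L^2(X))$; this operator then has a unique weak* continuous extension $M_\varphi\colon B(L^2(X))\to B(L^2(X))$, called the measurable Schur multiplier with symbol $\varphi$. It is positive if it maps positive operators to positive operators. *)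

theory Defs
  imports "HOL-Analysis.Analysis"
begin

section \<open>Complex Hilbert spaces on a carrier set\<close>

text \<open>
  The space \<open>L\<^sup>2(X)\<close> depends on a measure, that is, on a term, so it cannot be a type; and the
  Hilbert space whose existence is claimed in the theorem has to be a value.  Hilbert spaces are
  therefore given by a carrier set together with their operations.
  Inner products are linear in the first argument.
\<close>

record 'h hspace =
  hcarrier :: "'h set"
  hzero :: 'h
  hadd :: "'h \<Rightarrow> 'h \<Rightarrow> 'h"
  hscale :: "complex \<Rightarrow> 'h \<Rightarrow> 'h"
  hinner :: "'h \<Rightarrow> 'h \<Rightarrow> complex"

definition hnorm :: "'h hspace \<Rightarrow> 'h \<Rightarrow> real" where
  "hnorm H x = sqrt (Re (hinner H x x))"

text \<open>
  The locale \<^locale>\<open>Metric_space\<close> requires nonnegativity and symmetry of the distance also off the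
  carrier, hence the case distinction.
\<close>

definition hdist :: "'h hspace \<Rightarrow> 'h \<Rightarrow> 'h \<Rightarrow> real" where
  "hdist H x y = (if x \<in> hcarrier H \<and> y \<in> hcarrier H
     then hnorm H (hadd H x (hscale H (-1) y)) else 0)"

definition htopology :: "'h hspace \<Rightarrow> 'h topology" where
  "htopology H = Metric_space.mtopology (hcarrier H) (hdist H)"

locale complex_hilbert_space =
  fixes H :: "'h hspace"
  assumes zero_closed: "hzero H \<in> hcarrier H"
    and add_closed: "\<lbrakk>x \<in> hcarrier H; y \<in> hcarrier H\<rbrakk> \<Longrightarrow> hadd H x y \<in> hcarrier H"
    and scale_closed: "x \<in> hcarrier H \<Longrightarrow> hscale H a x \<in> hcarrier H"
    and add_assoc: "\<lbrakk>x \<in> hcarrier H; y \<in> hcarrier H; z \<in> hcarrier H\<rbrakk>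
      \<Longrightarrow> hadd H (hadd H x y) z = hadd H x (hadd H y z)"
    and add_commute: "\<lbrakk>x \<in> hcarrier H; y \<in> hcarrier H\<rbrakk> \<Longrightarrow> hadd H x y = hadd H y x"
    and add_zero: "x \<in> hcarrier H \<Longrightarrow> hadd H x (hzero H) = x"
    and add_neg: "x \<in> hcarrier H \<Longrightarrow> hadd H x (hscale H (-1) x) = hzero H"
    and scale_one: "x \<in> hcarrier H \<Longrightarrow> hscale H 1 x = x"
    and scale_scale: "x \<in> hcarrier H \<Longrightarrow> hscale H a (hscale H b x) = hscale H (a * b) x"
    and scale_add_left: "x \<in> hcarrier H
      \<Longrightarrow> hscale H (a + b) x = hadd H (hscale H a x) (hscale H b x)"
    and scale_add_right: "\<lbrakk>x \<in> hcarrier H; y \<in> hcarrier H\<rbrakk>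
      \<Longrightarrow> hscale H a (hadd H x y) = hadd H (hscale H a x) (hscale H a y)"
    and inner_add: "\<lbrakk>x \<in> hcarrier H; y \<in> hcarrier H; z \<in> hcarrier H\<rbrakk>
      \<Longrightarrow> hinner H (hadd H x y) z = hinner H x z + hinner H y z"
    and inner_scale: "\<lbrakk>x \<in> hcarrier H; y \<in> hcarrier H\<rbrakk>
      \<Longrightarrow> hinner H (hscale H a x) y = a * hinner H x y"
    and inner_commute: "\<lbrakk>x \<in> hcarrier H; y \<in> hcarrier H\<rbrakk> \<Longrightarrow> hinner H y x = cnj (hinner H x y)"
    and inner_nonneg: "x \<in> hcarrier H \<Longrightarrow> 0 \<le> Re (hinner H x x)"
    and inner_definite: "\<lbrakk>x \<in> hcarrier H; hinner H x x = 0\<rbrakk> \<Longrightarrow> x = hzero H"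
    and complete: "Metric_space.mcomplete (hcarrier H) (hdist H)"


section \<open>Operators\<close>

text \<open>
  Operators are extensional functions (\<open>undefined\<close> off the carrier), so that equality of the
  functions is equality of the operators.
\<close>

definition bounded_ops :: "'h hspace \<Rightarrow> ('h \<Rightarrow> 'h) set" where
  "bounded_ops H = {T \<in> hcarrier H \<rightarrow>\<^sub>E hcarrier H.
     (\<forall>x\<in>hcarrier H. \<forall>y\<in>hcarrier H. T (hadd H x y) = hadd H (T x) (T y)) \<and>
     (\<forall>a. \<forall>x\<in>hcarrier H. T (hscale H a x) = hscale H a (T x)) \<and>
     (\<exists>C. \<forall>x\<in>hcarrier H. hnorm H (T x) \<le> C * hnorm H x)}"

definition op_norm :: "'h hspace \<Rightarrow> ('h \<Rightarrow> 'h) \<Rightarrow> real" where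
  "op_norm H T = (SUP x\<in>{x \<in> hcarrier H. hnorm H x \<le> 1}. hnorm H (T x))"

definition op_add :: "'h hspace \<Rightarrow> ('h \<Rightarrow> 'h) \<Rightarrow> ('h \<Rightarrow> 'h) \<Rightarrow> 'h \<Rightarrow> 'h" where
  "op_add H S T = (\<lambda>x\<in>hcarrier H. hadd H (S x) (T x))"

definition op_scale :: "'h hspace \<Rightarrow> complex \<Rightarrow> ('h \<Rightarrow> 'h) \<Rightarrow> 'h \<Rightarrow> 'h" where
  "op_scale H a T = (\<lambda>x\<in>hcarrier H. hscale H a (T x))"

definition compact_ops :: "'h hspace \<Rightarrow> ('h \<Rightarrow> 'h) set" where
  "compact_ops H = {T \<in> bounded_ops H.
     compactin (htopology H)
       (htopology H closure_of (T ` {x \<in> hcarrier H. hnorm H x \<le> 1}))}"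

definition positive_op :: "'h hspace \<Rightarrow> ('h \<Rightarrow> 'h) \<Rightarrow> bool" where
  "positive_op H T \<longleftrightarrow> T \<in> bounded_ops H \<and>
     (\<forall>x\<in>hcarrier H. hinner H (T x) x \<in> \<real>\<^sub>\<ge>\<^sub>0)"

text \<open>
  The functionals \<open>T \<mapsto> \<Sum>n. \<langle>T \<xi>\<^sub>n, \<eta>\<^sub>n\<rangle>\<close> with \<open>\<Sum>n. \<parallel>\<xi>\<^sub>n\<parallel>\<^sup>2 < \<infinity>\<close> and \<open>\<Sum>n. \<parallel>\<eta>\<^sub>n\<parallel>\<^sup>2 < \<infinity>\<close> are exactly
  the functionals \<open>T \<mapsto> tr (T A)\<close> with \<open>A\<close> of trace class, i.e. the predual of \<open>B(H)\<close>.
\<close>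

definition l2_seq :: "'h hspace \<Rightarrow> (nat \<Rightarrow> 'h) \<Rightarrow> bool" where
  "l2_seq H \<xi> \<longleftrightarrow> range \<xi> \<subseteq> hcarrier H \<and> summable (\<lambda>n. (hnorm H (\<xi> n))\<^sup>2)"

definition weak_star_topology :: "'h hspace \<Rightarrow> ('h \<Rightarrow> 'h) topology" where
  "weak_star_topology H = topology_generated_by
     {{T \<in> bounded_ops H. (\<Sum>n. hinner H (T (\<xi> n)) (\<eta> n)) \<in> U} | \<xi> \<eta> U.
        l2_seq H \<xi> \<and> l2_seq H \<eta> \<and> open U}"

definition bounded_linear_on_compacts ::
    "'h hspace \<Rightarrow> (('h \<Rightarrow> 'h) \<Rightarrow> ('h \<Rightarrow> 'h)) \<Rightarrow> bool" where
  "bounded_linear_on_compacts H \<Psi> \<longleftrightarrow>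
     \<Psi> ` compact_ops H \<subseteq> bounded_ops H \<and>
     (\<forall>S\<in>compact_ops H. \<forall>T\<in>compact_ops H. \<Psi> (op_add H S T) = op_add H (\<Psi> S) (\<Psi> T)) \<and>
     (\<forall>a. \<forall>T\<in>compact_ops H. \<Psi> (op_scale H a T) = op_scale H a (\<Psi> T)) \<and>
     (\<exists>C. \<forall>T\<in>compact_ops H. op_norm H (\<Psi> T) \<le> C * op_norm H T)"


section \<open>The Hilbert space \<open>L\<^sup>2(X)\<close> and integral operators\<close>

definition square_integrable :: "'a measure \<Rightarrow> ('a \<Rightarrow> complex) \<Rightarrow> bool" where
  "square_integrable M f \<longleftrightarrow>
     f \<in> borel_measurable M \<and> integrable M (\<lambda>x. (norm (f x))\<^sup>2)"

definition L2_class :: "'a measure \<Rightarrow> ('a \<Rightarrow> complex) \<Rightarrow> ('a \<Rightarrow> complex) set" where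
  "L2_class M f = {g. square_integrable M g \<and> (AE x in M. g x = f x)}"

definition L2_rep :: "('a \<Rightarrow> complex) set \<Rightarrow> 'a \<Rightarrow> complex" where
  "L2_rep u = (SOME f. f \<in> u)"

definition L2 :: "'a measure \<Rightarrow> ('a \<Rightarrow> complex) set hspace" where
  "L2 M = \<lparr>
     hcarrier = L2_class M ` {f. square_integrable M f},
     hzero = L2_class M (\<lambda>_. 0),
     hadd = (\<lambda>u v. L2_class M (\<lambda>x. L2_rep u x + L2_rep v x)),
     hscale = (\<lambda>a u. L2_class M (\<lambda>x. a * L2_rep u x)),
     hinner = (\<lambda>u v. LINT x|M. L2_rep u x * cnj (L2_rep v x))\<rparr>"

text \<open>
  All measure spaces are complete, so \<open>X \<times> X\<close> carries the completed product measure.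
\<close>

abbreviation square_measure :: "'a measure \<Rightarrow> ('a \<times> 'a) measure" where
  "square_measure M \<equiv> completion (M \<Otimes>\<^sub>M M)"

definition essentially_bounded :: "'a measure \<Rightarrow> ('a \<Rightarrow> complex) \<Rightarrow> bool" where
  "essentially_bounded M f \<longleftrightarrow>
     f \<in> borel_measurable M \<and> (\<exists>C. AE x in M. norm (f x) \<le> C)"

definition kernel_op ::
    "'a measure \<Rightarrow> ('a \<times> 'a \<Rightarrow> complex) \<Rightarrow> ('a \<Rightarrow> complex) set \<Rightarrow> ('a \<Rightarrow> complex) set" where
  "kernel_op M f =
     (\<lambda>u\<in>hcarrier (L2 M). L2_class M (\<lambda>x. LINT y|M. f (x, y) * L2_rep u y))"


section \<open>Measurable Schur multipliers\<close>

definition schur_map_on_compacts :: "'a measure \<Rightarrow> ('a \<times> 'a \<Rightarrow> complex) \<Rightarrow>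
    ((('a \<Rightarrow> complex) set \<Rightarrow> ('a \<Rightarrow> complex) set) \<Rightarrow> (('a \<Rightarrow> complex) set \<Rightarrow> ('a \<Rightarrow> complex) set))
    \<Rightarrow> bool" where
  "schur_map_on_compacts M \<phi> \<Psi> \<longleftrightarrow>
     bounded_linear_on_compacts (L2 M) \<Psi> \<and>
     (\<forall>f. square_integrable (square_measure M) f \<longrightarrow>
        \<Psi> (kernel_op M f) = kernel_op M (\<lambda>z. \<phi> z * f z))"

text \<open>
  \<open>\<Phi>\<close> is the operator \<open>M\<^sub>\<phi>\<close> on \<open>B(L\<^sup>2(X))\<close>: the symbol \<open>\<phi>\<close> induces a bounded operator on the
  compact operators, and \<open>\<Phi>\<close> is its weak* continuous extension.  Uniqueness, linearity and
  boundedness of \<open>\<Phi>\<close> are consequences, since the compact operators are weak* dense.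
\<close>

definition measurable_schur_multiplier :: "'a measure \<Rightarrow> ('a \<times> 'a \<Rightarrow> complex) \<Rightarrow>
    ((('a \<Rightarrow> complex) set \<Rightarrow> ('a \<Rightarrow> complex) set) \<Rightarrow> (('a \<Rightarrow> complex) set \<Rightarrow> ('a \<Rightarrow> complex) set))
    \<Rightarrow> bool" where
  "measurable_schur_multiplier M \<phi> \<Phi> \<longleftrightarrow>
     essentially_bounded (square_measure M) \<phi> \<and>
     (\<exists>\<Psi>. schur_map_on_compacts M \<phi> \<Psi> \<and>
        (\<forall>T\<in>compact_ops (L2 M). \<Phi> T = \<Psi> T)) \<and>
     continuous_map (weak_star_topology (L2 M)) (weak_star_topology (L2 M)) \<Phi>"

definition positive_map :: "'h hspace \<Rightarrow> (('h \<Rightarrow> 'h) \<Rightarrow> ('h \<Rightarrow> 'h)) \<Rightarrow> bool" where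
  "positive_map H \<Phi> \<longleftrightarrow> (\<forall>T. positive_op H T \<longrightarrow> positive_op H (\<Phi> T))"


section \<open>Radon measures\<close>

text \<open>
  A Radon measure is a complete measure on a \<open>\<sigma>\<close>-algebra containing the Borel sets that is finite
  on compact sets and inner regular with respect to compact sets.  The other common definition
  (outer regular on Borel sets, inner regular on open sets) implies this one, after completion,
  for \<open>\<sigma>\<close>-finite measures.
\<close>

definition radon_measure :: "'a::t2_space measure \<Rightarrow> bool" where
  "radon_measure M \<longleftrightarrow>
     space M = UNIV \<and> sets borel \<subseteq> sets M \<and> complete_measure M \<and>
     (\<forall>K. compact K \<longrightarrow> emeasure M K < \<infinity>) \<and>
     (\<forall>A\<in>sets M. emeasure M A = (SUP K\<in>{K. compact K \<and> K \<subseteq> A}. emeasure M K))"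

definition full_support :: "'a::topological_space measure \<Rightarrow> bool" where
  "full_support M \<longleftrightarrow> (\<forall>U. open U \<and> U \<noteq> {} \<longrightarrow> emeasure M U > 0)"

end

theory Submission
  imports Defs
begin

text \<open>
  A positive multiplier maps the positive operator with kernel \<open>1\<^sub>A\<^sub>\<times>\<^sub>A\<close>, where \<open>A\<close> has finite
  measure, to the operator with kernel \<open>\<phi> \<cdot> 1\<^sub>A\<^sub>\<times>\<^sub>A\<close>, which is therefore positive.  Evaluating its
  quadratic form at a combination of normalised indicators of small neighbourhoods of points
  \<open>x\<^sub>i\<close> of \<open>A\<close> gives, up to an arbitrarily small error by continuity of \<open>\<phi>\<close>, the number
  \<open>\<Sum>\<^sub>i\<^sub>,\<^sub>j a\<^sub>i cnj a\<^sub>j \<phi>(x\<^sub>i, x\<^sub>j)\<close>, so these numbers are nonnegative (\<open>gram_approx\<close>,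
  \<open>positive_symbol_kernel\<close>).  Local compactness provides neighbourhoods of finite measure, and
  full support makes their measure positive, so that the indicators can be normalised.

  Hence \<open>\<phi>\<close> is a positive definite kernel, and \<open>\<alpha>\<^sub>x = \<phi>(x, \<cdot>)\<close> in its reproducing kernel Hilbert
  space (Moore and Aronszajn; \<open>rkhs_hilbert\<close>, \<open>kernel_factors\<close>) gives the factorisation.  As
  \<open>\<parallel>\<alpha>\<^sub>x\<parallel>\<^sup>2 = \<phi>(x, x)\<close>, boundedness of \<open>\<alpha>\<close> is that of \<open>\<phi>\<close>, where full support turns the essential
  bound into a bound (\<open>essentially_bounded_imp_bounded\<close>); continuity of \<open>\<alpha>\<close> is continuity of
  \<open>\<parallel>\<alpha>\<^sub>x - \<alpha>\<^sub>y\<parallel>\<^sup>2 = \<phi>(x, x) - \<phi>(x, y) - \<phi>(y, x) + \<phi>(y, y)\<close>.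
\<close>


section \<open>Semi-inner products\<close>

locale semi_inner_space =
  fixes H :: "'h hspace"
  assumes add_closed: "\<lbrakk>x \<in> hcarrier H; y \<in> hcarrier H\<rbrakk> \<Longrightarrow> hadd H x y \<in> hcarrier H"
    and scale_closed: "x \<in> hcarrier H \<Longrightarrow> hscale H a x \<in> hcarrier H"
    and inner_add: "\<lbrakk>x \<in> hcarrier H; y \<in> hcarrier H; z \<in> hcarrier H\<rbrakk>
      \<Longrightarrow> hinner H (hadd H x y) z = hinner H x z + hinner H y z"
    and inner_scale: "\<lbrakk>x \<in> hcarrier H; y \<in> hcarrier H\<rbrakk>
      \<Longrightarrow> hinner H (hscale H a x) y = a * hinner H x y"
    and inner_commute: "\<lbrakk>x \<in> hcarrier H; y \<in> hcarrier H\<rbrakk> \<Longrightarrow> hinner H y x = cnj (hinner H x y)"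
    and inner_nonneg: "x \<in> hcarrier H \<Longrightarrow> 0 \<le> Re (hinner H x x)"
begin

abbreviation (input) diff :: "'h \<Rightarrow> 'h \<Rightarrow> 'h" where
  "diff x y \<equiv> hadd H x (hscale H (-1) y)"

lemma inner_add_right:
  "\<lbrakk>x \<in> hcarrier H; y \<in> hcarrier H; z \<in> hcarrier H\<rbrakk>
    \<Longrightarrow> hinner H z (hadd H x y) = hinner H z x + hinner H z y"
  by (metis add_closed complex_cnj_add inner_add inner_commute)

lemma inner_scale_right:
  "\<lbrakk>x \<in> hcarrier H; y \<in> hcarrier H\<rbrakk> \<Longrightarrow> hinner H x (hscale H a y) = cnj a * hinner H x y"
  by (metis complex_cnj_mult inner_commute inner_scale scale_closed)

lemmas inner_expand = inner_add inner_add_right inner_scale inner_scale_right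
  add_closed scale_closed

lemma norm_nonneg: "x \<in> hcarrier H \<Longrightarrow> 0 \<le> hnorm H x"
  by (simp add: hnorm_def inner_nonneg)

lemma inner_self: "x \<in> hcarrier H \<Longrightarrow> hinner H x x = complex_of_real ((hnorm H x)\<^sup>2)"
proof -
  assume x: "x \<in> hcarrier H"
  then have "Im (hinner H x x) = 0"
    using arg_cong[OF inner_commute[OF x x], of Im] by simp
  then show ?thesis
    using inner_nonneg[OF x] by (simp add: complex_eq_iff hnorm_def)
qed

lemma Cauchy_Schwarz:
  assumes x: "x \<in> hcarrier H" and y: "y \<in> hcarrier H"
  shows "cmod (hinner H x y) \<le> hnorm H x * hnorm H y"
proof -
  define z where "z = hinner H x y"
  define a where "a = (hnorm H x)\<^sup>2"
  define b where "b = (hnorm H y)\<^sup>2"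
  have zx: "hinner H y x = cnj z" using inner_commute[OF x y] by (simp add: z_def)
  have nonneg: "0 \<le> a - 2 * t * (cmod z)\<^sup>2 + t\<^sup>2 * (cmod z)\<^sup>2 * b" for t :: real
  proof -
    let ?w = "hadd H x (hscale H (- of_real t * z) y)"
    have zz: "z * cnj z = complex_of_real ((cmod z)\<^sup>2)" by (rule complex_norm_square[symmetric])
    have "hinner H ?w ?w = of_real a + cnj (- of_real t * z) * z + (- of_real t * z) * cnj z
        + (- of_real t * z) * cnj (- of_real t * z) * of_real b"
      using x y by (simp add: inner_expand inner_self[OF x] inner_self[OF y] zx a_def b_def z_def[symmetric] algebra_simps)
    also have "\<dots> = of_real a - 2 * of_real t * (z * cnj z) + of_real (t\<^sup>2) * (z * cnj z) * of_real b"
      by (simp add: algebra_simps power2_eq_square)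
    also have "\<dots> = complex_of_real (a - 2 * t * (cmod z)\<^sup>2 + t\<^sup>2 * (cmod z)\<^sup>2 * b)"
      unfolding zz by simp
    finally show ?thesis using inner_nonneg[of ?w] x y by (simp add: add_closed scale_closed)
  qed
  \<comment> \<open>The best \<open>t\<close> is \<open>1 / b\<close>; for \<open>b = 0\<close> a large \<open>t\<close> makes the left side negative unless \<open>z = 0\<close>.\<close>
  have "(cmod z)\<^sup>2 \<le> a * b"
  proof (cases "b = 0")
    case True
    have "(cmod z)\<^sup>2 = 0"
    proof (rule ccontr)
      assume nz: "(cmod z)\<^sup>2 \<noteq> 0"
      have "0 \<le> a - 2 * ((a + 1) / (2 * (cmod z)\<^sup>2)) * (cmod z)\<^sup>2"
        using nonneg[of "(a + 1) / (2 * (cmod z)\<^sup>2)"] True by simp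
      also have "\<dots> = -1" using nz by (simp add: field_simps)
      finally show False by simp
    qed
    then show ?thesis using True by simp
  next
    case False
    then have b: "b > 0" by (simp add: b_def)
    have "0 \<le> a - (cmod z)\<^sup>2 / b"
      using nonneg[of "1 / b"] b by (simp add: power2_eq_square)
    then show ?thesis using b by (simp add: field_simps)
  qed
  then have "(cmod z)\<^sup>2 \<le> (hnorm H x * hnorm H y)\<^sup>2"
    by (simp add: a_def b_def power_mult_distrib)
  then show ?thesis unfolding z_def
    by (rule power2_le_imp_le) (simp add: norm_nonneg x y)
qed

lemma norm_scale:
  assumes "x \<in> hcarrier H"
  shows "hnorm H (hscale H a x) = cmod a * hnorm H x"
proof -
  have "hinner H (hscale H a x) (hscale H a x) = (a * cnj a) * of_real ((hnorm H x)\<^sup>2)"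
    using assms by (simp add: inner_expand inner_self[OF assms])
  also have "\<dots> = of_real ((cmod a * hnorm H x)\<^sup>2)"
    unfolding complex_norm_square[symmetric] by (simp add: power_mult_distrib)
  finally have "hnorm H (hscale H a x) = sqrt ((cmod a * hnorm H x)\<^sup>2)"
    by (simp add: hnorm_def[of H "hscale H a x"])
  then show ?thesis
    using norm_nonneg[OF assms] by simp
qed

lemma norm_add:
  assumes x: "x \<in> hcarrier H" and y: "y \<in> hcarrier H"
  shows "hnorm H (hadd H x y) \<le> hnorm H x + hnorm H y"
proof (rule power2_le_imp_le)
  have "hinner H (hadd H x y) (hadd H x y)
      = of_real ((hnorm H x)\<^sup>2) + of_real ((hnorm H y)\<^sup>2) + (hinner H x y + cnj (hinner H x y))"
    using x y inner_commute[OF x y] by (simp add: inner_expand inner_self[OF x] inner_self[OF y])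
  also have "\<dots> = of_real ((hnorm H x)\<^sup>2 + (hnorm H y)\<^sup>2 + 2 * Re (hinner H x y))"
    by (simp add: complex_add_cnj)
  finally have "(hnorm H (hadd H x y))\<^sup>2 = (hnorm H x)\<^sup>2 + (hnorm H y)\<^sup>2 + 2 * Re (hinner H x y)"
    using inner_self[OF add_closed[OF x y]] of_real_eq_iff by metis
  also have "\<dots> \<le> (hnorm H x + hnorm H y)\<^sup>2"
    using Cauchy_Schwarz[OF x y] complex_Re_le_cmod[of "hinner H x y"]
    by (simp add: power2_sum)
  finally show "(hnorm H (hadd H x y))\<^sup>2 \<le> (hnorm H x + hnorm H y)\<^sup>2" .
qed (simp add: norm_nonneg x y)

lemma dist_eq: "\<lbrakk>x \<in> hcarrier H; y \<in> hcarrier H\<rbrakk> \<Longrightarrow> hdist H x y = hnorm H (diff x y)"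
  by (simp add: hdist_def)

lemma dist_square:
  assumes "x \<in> hcarrier H" "y \<in> hcarrier H"
  shows "(hdist H x y)\<^sup>2 = Re (hinner H x x - hinner H x y - hinner H y x + hinner H y y)"
proof -
  have "(hdist H x y)\<^sup>2 = Re (hinner H (diff x y) (diff x y))"
    using assms by (simp add: dist_eq inner_self add_closed scale_closed)
  then show ?thesis using assms by (simp add: inner_expand)
qed

lemma dist_nonneg: "0 \<le> hdist H x y"
  by (simp add: hdist_def norm_nonneg add_closed scale_closed)

lemma dist_commute: "hdist H x y = hdist H y x"
proof (cases "x \<in> hcarrier H \<and> y \<in> hcarrier H")
  case True
  then have "(hdist H x y)\<^sup>2 = (hdist H y x)\<^sup>2"
    using inner_commute[of x y] by (simp add: dist_square)
  then show ?thesis by (simp add: dist_nonneg)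
qed (auto simp: hdist_def)

text \<open>
  Vectors enter a norm only through their inner products.  So \<open>(x - y) + (y - z)\<close> has the same
  norm as \<open>x - z\<close> even where addition obeys no laws, as for the lists used below.
\<close>

lemma dist_triangle:
  assumes "x \<in> hcarrier H" "y \<in> hcarrier H" "z \<in> hcarrier H"
  shows "hdist H x z \<le> hdist H x y + hdist H y z"
proof -
  have "hinner H (diff x z) (diff x z)
      = hinner H (hadd H (diff x y) (diff y z)) (hadd H (diff x y) (diff y z))"
    using assms by (simp add: inner_expand)
  then have "hdist H x z = hnorm H (hadd H (diff x y) (diff y z))"
    using assms by (simp add: dist_eq hnorm_def)
  also have "\<dots> \<le> hnorm H (diff x y) + hnorm H (diff y z)"
    using assms by (intro norm_add) (simp_all add: add_closed scale_closed)
  finally show ?thesis using assms by (simp add: dist_eq)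
qed

lemma dist_add:
  assumes "x \<in> hcarrier H" "y \<in> hcarrier H" "x' \<in> hcarrier H" "y' \<in> hcarrier H"
  shows "hdist H (hadd H x y) (hadd H x' y') \<le> hdist H x x' + hdist H y y'"
proof -
  have "hinner H (diff (hadd H x y) (hadd H x' y')) (diff (hadd H x y) (hadd H x' y'))
      = hinner H (hadd H (diff x x') (diff y y')) (hadd H (diff x x') (diff y y'))"
    using assms by (simp add: inner_expand algebra_simps)
  then have "hdist H (hadd H x y) (hadd H x' y') = hnorm H (hadd H (diff x x') (diff y y'))"
    using assms by (simp add: dist_eq hnorm_def add_closed)
  also have "\<dots> \<le> hnorm H (diff x x') + hnorm H (diff y y')"
    using assms by (intro norm_add) (simp_all add: add_closed scale_closed)
  finally show ?thesis using assms by (simp add: dist_eq)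
qed

lemma dist_scale:
  assumes "x \<in> hcarrier H" "y \<in> hcarrier H"
  shows "hdist H (hscale H a x) (hscale H a y) = cmod a * hdist H x y"
proof -
  have "hinner H (diff (hscale H a x) (hscale H a y)) (diff (hscale H a x) (hscale H a y))
      = hinner H (hscale H a (diff x y)) (hscale H a (diff x y))"
    using assms by (simp add: inner_expand algebra_simps)
  then have "hdist H (hscale H a x) (hscale H a y) = hnorm H (hscale H a (diff x y))"
    using assms by (simp add: dist_eq hnorm_def scale_closed)
  then show ?thesis using assms by (simp add: dist_eq norm_scale add_closed scale_closed)
qed

lemma inner_diff_bound:
  assumes "x \<in> hcarrier H" "y \<in> hcarrier H" "z \<in> hcarrier H"
  shows "cmod (hinner H x z - hinner H y z) \<le> hdist H x y * hnorm H z"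
    and "cmod (hinner H z x - hinner H z y) \<le> hnorm H z * hdist H x y"
  using assms Cauchy_Schwarz[of "diff x y" z] Cauchy_Schwarz[of z "diff x y"]
  by (simp_all add: dist_eq inner_expand)


definition Cauchy_seq :: "(nat \<Rightarrow> 'h) \<Rightarrow> bool" where
  "Cauchy_seq s \<longleftrightarrow> range s \<subseteq> hcarrier H \<and>
     (\<forall>e>0. \<exists>N. \<forall>m\<ge>N. \<forall>n\<ge>N. hdist H (s m) (s n) < e)"

lemma Cauchy_seq_carrier: "Cauchy_seq s \<Longrightarrow> s n \<in> hcarrier H"
  by (auto simp: Cauchy_seq_def)

lemma Cauchy_seqD:
  assumes "Cauchy_seq s" "e > 0"
  shows "\<exists>N. \<forall>m\<ge>N. \<forall>n\<ge>N. hdist H (s m) (s n) < e"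
  using assms unfolding Cauchy_seq_def by blast

lemma norm_le_dist:
  assumes "x \<in> hcarrier H" "y \<in> hcarrier H"
  shows "hnorm H x \<le> hdist H x y + hnorm H y"
proof -
  have "hinner H x x = hinner H (hadd H (diff x y) y) (hadd H (diff x y) y)"
    using assms by (simp add: inner_expand)
  then have "hnorm H x = hnorm H (hadd H (diff x y) y)" by (simp add: hnorm_def)
  also have "\<dots> \<le> hnorm H (diff x y) + hnorm H y"
    using assms by (intro norm_add) (simp_all add: add_closed scale_closed)
  finally show ?thesis using assms by (simp add: dist_eq)
qed

lemma Cauchy_seq_bounded:
  assumes "Cauchy_seq s"
  shows "\<exists>B>0. \<forall>n. hnorm H (s n) \<le> B"
proof -
  obtain N where N: "\<And>m n. \<lbrakk>m \<ge> N; n \<ge> N\<rbrakk> \<Longrightarrow> hdist H (s m) (s n) < 1"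
    using Cauchy_seqD[OF assms zero_less_one] by blast
  have c: "s n \<in> hcarrier H" for n using Cauchy_seq_carrier[OF assms] .
  define B where "B = 1 + (\<Sum>n\<le>N. hnorm H (s n))"
  have le: "hnorm H (s n) \<le> (\<Sum>n\<le>N. hnorm H (s n))" if "n \<le> N" for n
    using that by (intro member_le_sum) (auto simp: norm_nonneg c)
  have "hnorm H (s n) \<le> B" for n
  proof (cases "n \<le> N")
    case True
    then show ?thesis using le[OF True] by (simp add: B_def)
  next
    case False
    then have "hdist H (s n) (s N) < 1" by (intro N) auto
    then show ?thesis
      using norm_le_dist[OF c c, of n N] le[of N] by (simp add: B_def)
  qed
  moreover have "B > 0"
    unfolding B_def by (intro add_pos_nonneg sum_nonneg) (simp_all add: norm_nonneg c)
  ultimately show ?thesis by blast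
qed

lemma convergent_inner:
  assumes s: "Cauchy_seq s" and t: "Cauchy_seq t"
  shows "convergent (\<lambda>n. hinner H (s n) (t n))"
proof (rule Cauchy_convergent, rule CauchyI)
  fix e :: real assume e: "e > 0"
  obtain B where B: "B > 0" "\<And>n. hnorm H (s n) \<le> B" using Cauchy_seq_bounded[OF s] by blast
  obtain C where C: "C > 0" "\<And>n. hnorm H (t n) \<le> C" using Cauchy_seq_bounded[OF t] by blast
  obtain N1 where N1: "\<And>m n. \<lbrakk>m \<ge> N1; n \<ge> N1\<rbrakk> \<Longrightarrow> hdist H (s m) (s n) < e / (2 * C)"
    using Cauchy_seqD[OF s, of "e / (2 * C)"] e C by (meson divide_pos_pos mult_pos_pos zero_less_numeral)
  obtain N2 where N2: "\<And>m n. \<lbrakk>m \<ge> N2; n \<ge> N2\<rbrakk> \<Longrightarrow> hdist H (t m) (t n) < e / (2 * B)"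
    using Cauchy_seqD[OF t, of "e / (2 * B)"] e B by (meson divide_pos_pos mult_pos_pos zero_less_numeral)
  have c: "s n \<in> hcarrier H" "t n \<in> hcarrier H" for n
    using Cauchy_seq_carrier s t by auto
  have "cmod (hinner H (s m) (t m) - hinner H (s n) (t n)) < e"
    if mn: "m \<ge> max N1 N2" "n \<ge> max N1 N2" for m n
  proof -
    have "cmod (hinner H (s m) (t m) - hinner H (s n) (t n))
       \<le> cmod (hinner H (s m) (t m) - hinner H (s n) (t m))
         + cmod (hinner H (s n) (t m) - hinner H (s n) (t n))"
      using norm_triangle_ineq[of "hinner H (s m) (t m) - hinner H (s n) (t m)"
          "hinner H (s n) (t m) - hinner H (s n) (t n)"] by simp
    also have "\<dots> \<le> hdist H (s m) (s n) * hnorm H (t m) + hnorm H (s n) * hdist H (t m) (t n)"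
      by (intro add_mono inner_diff_bound c)
    also have "\<dots> \<le> hdist H (s m) (s n) * C + B * hdist H (t m) (t n)"
      by (intro add_mono mult_left_mono mult_right_mono B C dist_nonneg)
    also have "\<dots> < e / (2 * C) * C + B * (e / (2 * B))"
      using mn B C by (intro add_strict_mono mult_strict_right_mono mult_strict_left_mono N1 N2) auto
    also have "\<dots> = e" using B C by simp
    finally show ?thesis .
  qed
  then show "\<exists>M. \<forall>m\<ge>M. \<forall>n\<ge>M. norm (hinner H (s m) (t m) - hinner H (s n) (t n)) < e"
    by blast
qed

text \<open>
  In the completion such a sequence has a limit orthogonal to each \<open>u N\<close>, hence to itself.
\<close>

lemma Cauchy_seq_weakly_null:
  assumes u: "Cauchy_seq u" and weak: "\<And>N. (\<lambda>n. hinner H (u n) (u N)) \<longlonglongrightarrow> 0"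
  shows "(\<lambda>n. hnorm H (u n)) \<longlonglongrightarrow> 0"
proof -
  obtain B where B: "B > 0" "\<And>n. hnorm H (u n) \<le> B" using Cauchy_seq_bounded[OF u] by blast
  have c: "u n \<in> hcarrier H" for n using Cauchy_seq_carrier[OF u] .
  have "(\<lambda>n. (hnorm H (u n))\<^sup>2) \<longlonglongrightarrow> 0"
  proof (rule LIMSEQ_I)
    fix e :: real assume e: "e > 0"
    obtain N1 where N1: "\<And>m n. \<lbrakk>m \<ge> N1; n \<ge> N1\<rbrakk> \<Longrightarrow> hdist H (u m) (u n) < e / (2 * B)"
      using Cauchy_seqD[OF u, of "e / (2 * B)"] e B by (meson divide_pos_pos mult_pos_pos zero_less_numeral)
    obtain N2 where N2: "\<And>n. n \<ge> N2 \<Longrightarrow> cmod (hinner H (u n) (u N1)) < e / 2"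
      using LIMSEQ_D[OF weak[of N1], of "e / 2"] e by auto
    have "norm ((hnorm H (u n))\<^sup>2 - 0) < e" if n: "n \<ge> max N1 N2" for n
    proof -
      have "(hnorm H (u n))\<^sup>2 = cmod (hinner H (u n) (u n))"
        unfolding inner_self[OF c] norm_of_real by simp
      also have "\<dots> \<le> cmod (hinner H (u n) (u n) - hinner H (u n) (u N1))
          + cmod (hinner H (u n) (u N1))"
        using norm_triangle_ineq[of "hinner H (u n) (u n) - hinner H (u n) (u N1)"
            "hinner H (u n) (u N1)"] by simp
      also have "\<dots> \<le> hnorm H (u n) * hdist H (u n) (u N1) + cmod (hinner H (u n) (u N1))"
        by (intro add_right_mono inner_diff_bound c)
      also have "\<dots> \<le> B * hdist H (u n) (u N1) + cmod (hinner H (u n) (u N1))"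
        by (intro add_right_mono mult_right_mono B dist_nonneg)
      also have "\<dots> < B * (e / (2 * B)) + e / 2"
        using n B by (intro add_strict_mono mult_strict_left_mono N1 N2) auto
      also have "\<dots> = e" using B by simp
      finally show ?thesis by simp
    qed
    then show "\<exists>no. \<forall>n\<ge>no. norm ((hnorm H (u n))\<^sup>2 - 0) < e" by blast
  qed
  then have "(\<lambda>n. sqrt ((hnorm H (u n))\<^sup>2)) \<longlonglongrightarrow> sqrt 0" by (rule tendsto_real_sqrt)
  then show ?thesis by (simp add: norm_nonneg c)
qed

end


section \<open>Inner product spaces and rank one operators\<close>

locale complex_inner_space = semi_inner_space H for H :: "'h hspace" +
  assumes zero_closed: "hzero H \<in> hcarrier H"
    and add_assoc: "\<lbrakk>x \<in> hcarrier H; y \<in> hcarrier H; z \<in> hcarrier H\<rbrakk>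
      \<Longrightarrow> hadd H (hadd H x y) z = hadd H x (hadd H y z)"
    and add_commute: "\<lbrakk>x \<in> hcarrier H; y \<in> hcarrier H\<rbrakk> \<Longrightarrow> hadd H x y = hadd H y x"
    and add_zero: "x \<in> hcarrier H \<Longrightarrow> hadd H x (hzero H) = x"
    and add_neg: "x \<in> hcarrier H \<Longrightarrow> hadd H x (hscale H (-1) x) = hzero H"
    and scale_one: "x \<in> hcarrier H \<Longrightarrow> hscale H 1 x = x"
    and scale_scale: "x \<in> hcarrier H \<Longrightarrow> hscale H a (hscale H b x) = hscale H (a * b) x"
    and scale_add_left: "x \<in> hcarrier H
      \<Longrightarrow> hscale H (a + b) x = hadd H (hscale H a x) (hscale H b x)"
    and scale_add_right: "\<lbrakk>x \<in> hcarrier H; y \<in> hcarrier H\<rbrakk>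
      \<Longrightarrow> hscale H a (hadd H x y) = hadd H (hscale H a x) (hscale H a y)"
    and inner_definite: "\<lbrakk>x \<in> hcarrier H; hinner H x x = 0\<rbrakk> \<Longrightarrow> x = hzero H"
begin

lemma dist_eq_0:
  assumes "x \<in> hcarrier H" "y \<in> hcarrier H"
  shows "hdist H x y = 0 \<longleftrightarrow> x = y"
proof
  assume "hdist H x y = 0"
  then have "hinner H (diff x y) (diff x y) = 0"
    using assms by (simp add: dist_eq inner_self add_closed scale_closed)
  then have d: "diff x y = hzero H"
    using assms by (intro inner_definite) (simp_all add: add_closed scale_closed)
  have "x = hadd H x (hadd H (hscale H (-1) y) y)"
    using assms by (simp add: add_neg add_zero add_commute[of "hscale H (-1) y"] scale_closed)
  also have "\<dots> = hadd H (diff x y) y" using assms by (simp add: add_assoc scale_closed)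
  also have "\<dots> = y" using assms by (simp add: d add_commute[of "hzero H"] zero_closed add_zero)
  finally show "x = y" .
next
  assume "x = y"
  then show "hdist H x y = 0"
    using assms dist_square[of x y] by simp
qed

lemma metric_space: "Metric_space (hcarrier H) (hdist H)"
  by unfold_locales (auto simp: dist_nonneg dist_eq_0 dist_triangle intro: dist_commute)

lemma dist_scale_left:
  assumes "x \<in> hcarrier H"
  shows "hdist H (hscale H a x) (hscale H b x) = cmod (a - b) * hnorm H x"
  using assms scale_add_left[of x a "- b"]
  by (simp add: dist_eq scale_closed scale_scale flip: norm_scale)

definition rank_one :: "'h \<Rightarrow> 'h \<Rightarrow> 'h" where
  "rank_one e = (\<lambda>u\<in>hcarrier H. hscale H (hinner H u e) e)"

lemma rank_one_bounded:
  assumes e: "e \<in> hcarrier H"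
  shows "rank_one e \<in> bounded_ops H"
proof -
  have "hnorm H (rank_one e x) \<le> (hnorm H e)\<^sup>2 * hnorm H x" if x: "x \<in> hcarrier H" for x
    using x e mult_right_mono[OF Cauchy_Schwarz[OF x e] norm_nonneg[OF e]]
    by (simp add: rank_one_def norm_scale power2_eq_square mult_ac)
  then show ?thesis
    using e unfolding bounded_ops_def
    by (auto simp: rank_one_def add_closed scale_closed inner_add inner_scale
        scale_add_left scale_scale intro!: exI[of _ "(hnorm H e)\<^sup>2"])
qed

lemma rank_one_positive:
  assumes "e \<in> hcarrier H"
  shows "positive_op H (rank_one e)"
  unfolding positive_op_def
proof (intro conjI ballI)
  fix x assume x: "x \<in> hcarrier H"
  have "hinner H (rank_one e x) x = hinner H x e * cnj (hinner H x e)"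
    using x assms inner_commute[of x e] by (simp add: rank_one_def inner_scale)
  then show "hinner H (rank_one e x) x \<in> \<real>\<^sub>\<ge>\<^sub>0"
    by (metis complex_norm_square nonneg_Reals_of_real_iff zero_le_power2)
qed (rule rank_one_bounded[OF assms])

text \<open>
  The image of the unit ball lies in the image of a closed disc under \<open>a \<mapsto> a \<cdot> e\<close>.
\<close>

lemma rank_one_compact:
  assumes e: "e \<in> hcarrier H"
  shows "rank_one e \<in> compact_ops H"
proof -
  interpret Metric_space "hcarrier H" "hdist H" by (rule metric_space)
  have top: "htopology H = mtopology" by (simp add: htopology_def)
  let ?f = "\<lambda>a. hscale H a e"
  have cont: "continuous_map euclidean mtopology ?f"
    unfolding continuous_map_to_metric
  proof (intro ballI allI impI)
    fix a :: complex and d :: real assume d: "d > 0"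
    let ?r = "d / (hnorm H e + 1)"
    have r: "?r > 0" using d norm_nonneg[OF e] by simp
    have "hscale H b e \<in> mball (hscale H a e) d" if "b \<in> ball a ?r" for b
    proof -
      have "hdist H (?f a) (?f b) = cmod (a - b) * hnorm H e" by (rule dist_scale_left[OF e])
      also have "\<dots> \<le> cmod (a - b) * (hnorm H e + 1)" by (simp add: mult_left_mono)
      also have "\<dots> < d"
        using that norm_nonneg[OF e] by (simp add: dist_norm pos_less_divide_eq)
      finally show ?thesis by (simp add: in_mball scale_closed e)
    qed
    then show "\<exists>U. openin euclidean U \<and> a \<in> U \<and> (\<forall>y\<in>U. hscale H y e \<in> mball (hscale H a e) d)"
      using r by (intro exI[of _ "ball a ?r"]) simp
  qed
  define K where "K = ?f ` cball 0 (hnorm H e)"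
  have K: "compactin mtopology K"
    unfolding K_def by (rule image_compactin[OF _ cont]) simp
  have "rank_one e ` {x \<in> hcarrier H. hnorm H x \<le> 1} \<subseteq> K"
  proof safe
    fix x assume x: "x \<in> hcarrier H" "hnorm H x \<le> 1"
    have "cmod (hinner H x e) \<le> hnorm H e"
      using Cauchy_Schwarz[OF x(1) e] mult_right_mono[OF x(2) norm_nonneg[OF e]] by simp
    then show "rank_one e x \<in> K" using x by (auto simp: K_def rank_one_def)
  qed
  moreover have "closedin mtopology K"
    by (rule compactin_imp_closedin[OF Hausdorff_space_mtopology K])
  ultimately have "mtopology closure_of (rank_one e ` {x \<in> hcarrier H. hnorm H x \<le> 1}) \<subseteq> K"
    by (simp add: closure_of_minimal)
  then show ?thesis
    unfolding compact_ops_def top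
    using rank_one_bounded[OF e] closed_compactin[OF K] by simp
qed

end


section \<open>The space of square integrable functions\<close>

lemma square_integrable_measurable: "square_integrable M f \<Longrightarrow> f \<in> borel_measurable M"
  by (simp add: square_integrable_def)

lemma square_integrable_scale: "square_integrable M f \<Longrightarrow> square_integrable M (\<lambda>x. a * f x)"
  by (auto simp: square_integrable_def norm_mult power_mult_distrib)

lemma square_integrable_add:
  assumes f: "square_integrable M f" and g: "square_integrable M g"
  shows "square_integrable M (\<lambda>x. f x + g x)"
proof -
  have [measurable]: "f \<in> borel_measurable M" "g \<in> borel_measurable M"
    using f g by (simp_all add: square_integrable_def)
  have "integrable M (\<lambda>x. 2 * (cmod (f x))\<^sup>2 + 2 * (cmod (g x))\<^sup>2)"
    using f g by (simp add: square_integrable_def)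
  then have "integrable M (\<lambda>x. (cmod (f x + g x))\<^sup>2)"
  proof (rule Bochner_Integration.integrable_bound, measurable, intro AE_I2)
    fix x
    have "(cmod (f x + g x))\<^sup>2 \<le> (cmod (f x) + cmod (g x))\<^sup>2"
      by (intro power_mono norm_triangle_ineq norm_ge_zero)
    also have "\<dots> \<le> 2 * (cmod (f x))\<^sup>2 + 2 * (cmod (g x))\<^sup>2"
      using sum_squares_bound[of "cmod (f x)" "cmod (g x)"] by (simp add: power2_sum)
    finally show "norm ((cmod (f x + g x))\<^sup>2) \<le> norm (2 * (cmod (f x))\<^sup>2 + 2 * (cmod (g x))\<^sup>2)"
      by simp
  qed
  then show ?thesis by (simp add: square_integrable_def)
qed

lemma square_integrable_product:
  assumes f: "square_integrable M f" and g: "square_integrable M g"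
  shows "integrable M (\<lambda>x. f x * cnj (g x))"
proof -
  have [measurable]: "f \<in> borel_measurable M" "g \<in> borel_measurable M"
    using f g by (simp_all add: square_integrable_def)
  have "integrable M (\<lambda>x. (cmod (f x))\<^sup>2 + (cmod (g x))\<^sup>2)"
    using f g by (simp add: square_integrable_def)
  then show ?thesis
  proof (rule Bochner_Integration.integrable_bound)
    have "cnj \<in> borel_measurable borel"
      by (intro borel_measurable_continuous_onI continuous_intros)
    then show "(\<lambda>x. f x * cnj (g x)) \<in> borel_measurable M" by measurable
  next
    show "AE x in M. norm (f x * cnj (g x)) \<le> norm ((cmod (f x))\<^sup>2 + (cmod (g x))\<^sup>2)"
    proof (rule AE_I2)
      fix x
      have "2 * (cmod (f x) * cmod (g x)) \<le> (cmod (f x))\<^sup>2 + (cmod (g x))\<^sup>2"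
        using sum_squares_bound[of "cmod (f x)" "cmod (g x)"] by (simp add: mult.assoc)
      then have "cmod (f x) * cmod (g x) \<le> (cmod (f x))\<^sup>2 + (cmod (g x))\<^sup>2"
        using mult_nonneg_nonneg[OF norm_ge_zero norm_ge_zero, of "f x" "g x"] by linarith
      then show "norm (f x * cnj (g x)) \<le> norm ((cmod (f x))\<^sup>2 + (cmod (g x))\<^sup>2)"
        by (simp add: norm_mult)
    qed
  qed
qed

lemma square_integrable_0: "square_integrable M (\<lambda>_. 0)"
  by (simp add: square_integrable_def)

lemma L2_class_eqI:
  assumes "AE x in M. f x = g x"
  shows "L2_class M f = L2_class M g"
  using assms unfolding L2_class_def by (auto elim: AE_mp)

lemma L2_carrierE:
  assumes "u \<in> hcarrier (L2 M)"
  obtains f where "square_integrable M f" "u = L2_class M f"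
  using assms by (auto simp: L2_def)

lemma L2_class_carrier: "square_integrable M f \<Longrightarrow> L2_class M f \<in> hcarrier (L2 M)"
  by (auto simp: L2_def)

text \<open>
  A member of the carrier is a nonempty class even when it is given by a representative that is
  not known to be measurable, and then its chosen representative is still equal to that one
  almost everywhere.
\<close>

lemma L2_rep:
  assumes "L2_class M f \<in> hcarrier (L2 M)"
  shows "square_integrable M (L2_rep (L2_class M f))"
    and "AE x in M. L2_rep (L2_class M f) x = f x"
proof -
  obtain g where g: "square_integrable M g" "L2_class M f = L2_class M g"
    using L2_carrierE[OF assms] .
  have "g \<in> L2_class M g" using g by (simp add: L2_class_def)
  then have "L2_rep (L2_class M f) \<in> L2_class M f"
    unfolding L2_rep_def g(2) by (rule someI[where P = "\<lambda>f. f \<in> L2_class M g"])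
  then show "square_integrable M (L2_rep (L2_class M f))"
    and "AE x in M. L2_rep (L2_class M f) x = f x"
    by (auto simp: L2_class_def)
qed

lemma L2_add:
  assumes f: "square_integrable M f" and g: "square_integrable M g"
  shows "hadd (L2 M) (L2_class M f) (L2_class M g) = L2_class M (\<lambda>x. f x + g x)"
proof -
  have "AE x in M. L2_rep (L2_class M f) x + L2_rep (L2_class M g) x = f x + g x"
    using L2_rep(2)[OF L2_class_carrier[OF f]] L2_rep(2)[OF L2_class_carrier[OF g]] by eventually_elim simp
  then show ?thesis by (simp add: L2_def L2_class_eqI)
qed

lemma L2_scale:
  assumes f: "square_integrable M f"
  shows "hscale (L2 M) a (L2_class M f) = L2_class M (\<lambda>x. a * f x)"
proof -
  have "AE x in M. a * L2_rep (L2_class M f) x = a * f x"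
    using L2_rep(2)[OF L2_class_carrier[OF f]] by eventually_elim simp
  then show ?thesis by (simp add: L2_def L2_class_eqI)
qed

lemma L2_inner:
  assumes f: "square_integrable M f" and g: "square_integrable M g"
  shows "hinner (L2 M) (L2_class M f) (L2_class M g) = (LINT x|M. f x * cnj (g x))"
proof -
  note f' = L2_rep[OF L2_class_carrier[OF f]]
  note g' = L2_rep[OF L2_class_carrier[OF g]]
  have "AE x in M. L2_rep (L2_class M f) x * cnj (L2_rep (L2_class M g) x) = f x * cnj (g x)"
    using f'(2) g'(2) by eventually_elim simp
  then have "(LINT x|M. L2_rep (L2_class M f) x * cnj (L2_rep (L2_class M g) x))
      = (LINT x|M. f x * cnj (g x))"
    using square_integrable_product[OF f'(1) g'(1)] square_integrable_product[OF f g]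
    by (intro integral_cong_AE) auto
  then show ?thesis by (simp add: L2_def)
qed

lemma L2_zero: "hzero (L2 M) = L2_class M (\<lambda>_. 0)"
  by (simp add: L2_def)

lemma L2_inner_product_space: "complex_inner_space (L2 M)"
proof -
  note ops = L2_add L2_scale L2_inner L2_zero L2_class_carrier square_integrable_0
    square_integrable_add square_integrable_scale
  note prod = square_integrable_product square_integrable_add square_integrable_scale
  have sq: "f x * cnj (f x) = complex_of_real ((cmod (f x))\<^sup>2)" for f :: "'a \<Rightarrow> complex" and x
    by (rule complex_norm_square[symmetric])
  show ?thesis
  proof
    fix x y assume "x \<in> hcarrier (L2 M)" "y \<in> hcarrier (L2 M)"
    then show "hadd (L2 M) x y \<in> hcarrier (L2 M)" by (auto elim!: L2_carrierE simp: ops)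
  next
    fix x a assume "x \<in> hcarrier (L2 M)"
    then show "hscale (L2 M) a x \<in> hcarrier (L2 M)" by (auto elim!: L2_carrierE simp: ops)
  next
    fix x y z assume "x \<in> hcarrier (L2 M)" "y \<in> hcarrier (L2 M)" "z \<in> hcarrier (L2 M)"
    then show "hinner (L2 M) (hadd (L2 M) x y) z = hinner (L2 M) x z + hinner (L2 M) y z"
      by (auto elim!: L2_carrierE simp: ops prod distrib_right)
  next
    fix x y a assume "x \<in> hcarrier (L2 M)" "y \<in> hcarrier (L2 M)"
    then show "hinner (L2 M) (hscale (L2 M) a x) y = a * hinner (L2 M) x y"
      by (auto elim!: L2_carrierE simp: ops prod mult.assoc)
  next
    fix x y assume "x \<in> hcarrier (L2 M)" "y \<in> hcarrier (L2 M)"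
    then obtain f g where "square_integrable M f" "x = L2_class M f"
        "square_integrable M g" "y = L2_class M g" by (auto elim!: L2_carrierE)
    then show "hinner (L2 M) y x = cnj (hinner (L2 M) x y)"
      by (simp add: ops flip: Bochner_Integration.integral_cnj) (simp add: mult.commute)
  next
    fix x assume "x \<in> hcarrier (L2 M)"
    then show "0 \<le> Re (hinner (L2 M) x x)"
      by (auto elim!: L2_carrierE simp: ops sq simp del: of_real_power)
  next
    show "hzero (L2 M) \<in> hcarrier (L2 M)" by (simp add: ops)
  next
    fix x y z assume "x \<in> hcarrier (L2 M)" "y \<in> hcarrier (L2 M)" "z \<in> hcarrier (L2 M)"
    then show "hadd (L2 M) (hadd (L2 M) x y) z = hadd (L2 M) x (hadd (L2 M) y z)"
      by (auto elim!: L2_carrierE simp: ops add.assoc)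
  next
    fix x y assume "x \<in> hcarrier (L2 M)" "y \<in> hcarrier (L2 M)"
    then show "hadd (L2 M) x y = hadd (L2 M) y x"
      by (auto elim!: L2_carrierE simp: ops add.commute)
  next
    fix x assume "x \<in> hcarrier (L2 M)"
    then show "hadd (L2 M) x (hzero (L2 M)) = x" by (auto elim!: L2_carrierE simp: ops)
  next
    fix x assume "x \<in> hcarrier (L2 M)"
    then obtain f where f: "square_integrable M f" "x = L2_class M f" by (auto elim!: L2_carrierE)
    show "hadd (L2 M) x (hscale (L2 M) (-1) x) = hzero (L2 M)"
      using f square_integrable_scale[OF f(1), of "-1"] by (simp add: ops)
  next
    fix x assume "x \<in> hcarrier (L2 M)"
    then show "hscale (L2 M) 1 x = x" by (auto elim!: L2_carrierE simp: ops)
  next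
    fix x a b assume "x \<in> hcarrier (L2 M)"
    then show "hscale (L2 M) a (hscale (L2 M) b x) = hscale (L2 M) (a * b) x"
      by (auto elim!: L2_carrierE simp: ops mult.assoc)
  next
    fix x a b assume "x \<in> hcarrier (L2 M)"
    then show "hscale (L2 M) (a + b) x = hadd (L2 M) (hscale (L2 M) a x) (hscale (L2 M) b x)"
      by (auto elim!: L2_carrierE simp: ops distrib_right)
  next
    fix x y a assume "x \<in> hcarrier (L2 M)" "y \<in> hcarrier (L2 M)"
    then show "hscale (L2 M) a (hadd (L2 M) x y) = hadd (L2 M) (hscale (L2 M) a x) (hscale (L2 M) a y)"
      by (auto elim!: L2_carrierE simp: ops distrib_left)
  next
    fix x assume "x \<in> hcarrier (L2 M)" and 0: "hinner (L2 M) x x = 0"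
    then obtain f where f: "square_integrable M f" "x = L2_class M f" by (auto elim!: L2_carrierE)
    have "complex_of_real (LINT x|M. (cmod (f x))\<^sup>2) = 0"
      using 0 f unfolding integral_complex_of_real[symmetric] by (simp add: ops sq)
    then have "AE x in M. (cmod (f x))\<^sup>2 = 0"
      using f by (subst integral_nonneg_eq_0_iff_AE[symmetric]) (simp_all add: square_integrable_def)
    then show "x = hzero (L2 M)" unfolding f L2_zero by (intro L2_class_eqI) auto
  qed
qed

lemma kernel_op_L2_class:
  assumes "square_integrable M g"
    and meas: "\<And>x. (\<lambda>y. f (x, y)) \<in> borel_measurable M"
  shows "kernel_op M f (L2_class M g) = L2_class M (\<lambda>x. LINT y|M. f (x, y) * g y)"
proof -
  note g' = L2_rep[OF L2_class_carrier[OF assms(1)]]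
  have "(LINT y|M. f (x, y) * L2_rep (L2_class M g) y) = (LINT y|M. f (x, y) * g y)" for x
    using g'(2) meas assms(1) g'(1)
    by (intro integral_cong_AE) (auto intro!: borel_measurable_times simp: square_integrable_def)
  then show ?thesis using L2_class_carrier[OF assms(1)] by (simp add: kernel_op_def)
qed

lemma square_integrable_indicator:
  assumes "A \<in> sets M" "emeasure M A < \<infinity>"
  shows "square_integrable M (indicator A)"
proof -
  have "(\<lambda>x. (cmod (indicator A x))\<^sup>2) = (indicator A :: _ \<Rightarrow> real)"
    by (auto simp: indicator_def)
  then show ?thesis using assms by (simp add: square_integrable_def)
qed

lemma kernel_op_indicator_square:
  assumes A: "A \<in> sets M" "emeasure M A < \<infinity>"
  shows "kernel_op M (indicator (A \<times> A)) = complex_inner_space.rank_one (L2 M) (L2_class M (indicator A))"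
proof -
  interpret complex_inner_space "L2 M" by (rule L2_inner_product_space)
  note e = square_integrable_indicator[OF A]
  have "kernel_op M (indicator (A \<times> A)) u = rank_one (L2_class M (indicator A)) u"
    if u: "u \<in> hcarrier (L2 M)" for u
  proof -
    obtain g where g: "square_integrable M g" "u = L2_class M g" using L2_carrierE[OF u] .
    have "(LINT y|M. indicator (A \<times> A) (x, y) * g y)
        = (LINT y|M. g y * cnj (indicator A y)) * indicator A x" for x
      by (cases "x \<in> A") (auto simp: indicator_def mult.commute intro!: Bochner_Integration.integral_cong)
    moreover have "(\<lambda>y. indicator (A \<times> A) (x, y) :: complex) \<in> borel_measurable M" for x
      using A(1) by (cases "x \<in> A") (simp_all add: indicator_times)
    ultimately show ?thesis
      using u g e by (simp add: kernel_op_L2_class rank_one_def L2_inner L2_scale)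
  qed
  then show ?thesis by (auto simp: kernel_op_def rank_one_def fun_eq_iff)
qed


section \<open>The reproducing kernel Hilbert space of a positive kernel\<close>

text \<open>
  A list of pairs stands for the formal combination \<open>\<Sum>a \<cdot> \<delta>\<^sub>x\<close>; concatenation is its addition.
  Unlike finitely supported functions, lists make the sesquilinearity of the Gram form immediate,
  and a semi-inner product space is not asked for vector space laws.
\<close>

definition gram :: "('a \<times> 'a \<Rightarrow> complex) \<Rightarrow> (complex \<times> 'a) list \<Rightarrow> (complex \<times> 'a) list \<Rightarrow> complex" where
  "gram k l m = (\<Sum>(a, x)\<leftarrow>l. \<Sum>(b, y)\<leftarrow>m. a * cnj b * k (x, y))"

definition combinations :: "('a \<times> 'a \<Rightarrow> complex) \<Rightarrow> (complex \<times> 'a) list hspace" where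
  "combinations k = \<lparr>hcarrier = UNIV, hzero = [], hadd = (@),
     hscale = (\<lambda>a. map (\<lambda>(b, x). (a * b, x))), hinner = gram k\<rparr>"

lemma combinations_simps [simp]:
  "hcarrier (combinations k) = UNIV" "hzero (combinations k) = []"
  "hadd (combinations k) = (@)" "hscale (combinations k) a = map (\<lambda>(b, x). (a * b, x))"
  "hinner (combinations k) = gram k"
  by (simp_all add: combinations_def)

lemma gram_append_left: "gram k (l @ l') m = gram k l m + gram k l' m"
  by (simp add: gram_def)

lemma gram_scale_left: "gram k (map (\<lambda>(b, x). (a * b, x)) l) m = a * gram k l m"
  by (induction l) (auto simp: gram_def sum_list_const_mult distrib_left mult.assoc split_def)

lemma gram_Cons_right: "gram k l ((b, y) # m) = cnj b * gram k l [(1, y)] + gram k l m"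
  by (induction l) (auto simp: gram_def algebra_simps)

lemma gram_Nil_right: "gram k l [] = 0"
  by (induction l) (auto simp: gram_def)

text \<open>
  Points of the space are the pointwise limits \<open>y \<mapsto> lim \<langle>s n, \<delta>\<^sub>y\<rangle>\<close> of sequences that are Cauchy in
  the Gram seminorm.  The completion is thus a space of functions, and the reproducing property
  is its very definition.
\<close>

definition represents ::
    "('a \<times> 'a \<Rightarrow> complex) \<Rightarrow> (nat \<Rightarrow> (complex \<times> 'a) list) \<Rightarrow> ('a \<Rightarrow> complex) \<Rightarrow> bool" where
  "represents k s f \<longleftrightarrow> semi_inner_space.Cauchy_seq (combinations k) s \<and>
     (\<forall>y. (\<lambda>n. gram k (s n) [(1, y)]) \<longlonglongrightarrow> f y)"

definition rkhs :: "('a \<times> 'a \<Rightarrow> complex) \<Rightarrow> ('a \<Rightarrow> complex) hspace" where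
  "rkhs k = \<lparr>hcarrier = {f. \<exists>s. represents k s f}, hzero = (\<lambda>_. 0),
     hadd = (\<lambda>f g x. f x + g x), hscale = (\<lambda>a f x. a * f x),
     hinner = (\<lambda>f g. lim (\<lambda>n. gram k ((SOME s. represents k s f) n) ((SOME s. represents k s g) n)))\<rparr>"

lemma rkhs_simps [simp]:
  "hzero (rkhs k) = (\<lambda>_. 0)" "hadd (rkhs k) f g = (\<lambda>x. f x + g x)"
  "hscale (rkhs k) a f = (\<lambda>x. a * f x)"
  by (simp_all add: rkhs_def)

lemma rkhs_carrier: "f \<in> hcarrier (rkhs k) \<longleftrightarrow> (\<exists>s. represents k s f)"
  by (simp add: rkhs_def)

locale positive_kernel =
  fixes k :: "'a \<times> 'a \<Rightarrow> complex"
  assumes gram_nonneg: "gram k l l \<in> \<real>\<^sub>\<ge>\<^sub>0"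
begin

text \<open>
  The Gram form is real on \<open>\<delta>\<^sub>x + \<delta>\<^sub>y\<close>, which settles the imaginary parts, and on
  \<open>\<delta>\<^sub>x + \<i> \<cdot> \<delta>\<^sub>y\<close>, which settles the real parts.
\<close>

lemma kernel_hermitian: "k (y, x) = cnj (k (x, y))"
proof -
  have real: "Im (gram k l l) = 0" for l
    using gram_nonneg[of l] by (auto simp: complex_nonneg_Reals_iff)
  show ?thesis
    using real[of "[(1, x)]"] real[of "[(1, y)]"] real[of "[(1, x), (1, y)]"] real[of "[(1, x), (\<i>, y)]"]
    by (simp add: gram_def complex_eq_iff)
qed

lemma gram_hermitian: "gram k m l = cnj (gram k l m)"
proof -
  have c: "cnj (sum_list (map f xs)) = sum_list (map (\<lambda>x. cnj (f x)) xs)"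
    for f :: "'b \<Rightarrow> complex" and xs by (induction xs) auto
  have swap: "(\<Sum>p\<leftarrow>l. \<Sum>q\<leftarrow>m. h p q) = (\<Sum>q\<leftarrow>m. \<Sum>p\<leftarrow>l. h p q)"
    for h :: "complex \<times> 'a \<Rightarrow> complex \<times> 'a \<Rightarrow> complex"
    by (induction l) (auto simp: sum_list_addf)
  have "cnj (gram k l m) = (\<Sum>p\<leftarrow>l. \<Sum>q\<leftarrow>m. fst q * cnj (fst p) * k (snd q, snd p))"
    unfolding gram_def c split_def
    by (simp add: kernel_hermitian[of "snd _" "snd _", symmetric] mult_ac)
  also have "\<dots> = gram k m l"
    unfolding swap gram_def split_def by simp
  finally show ?thesis by simp
qed

sublocale pre: semi_inner_space "combinations k"
proof
  fix l m :: "(complex \<times> 'a) list"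
  show "hinner (combinations k) m l = cnj (hinner (combinations k) l m)"
    using gram_hermitian[of m l] by simp
  show "0 \<le> Re (hinner (combinations k) l l)"
    using gram_nonneg[of l] by (simp add: complex_nonneg_Reals_iff)
qed (simp_all add: gram_append_left gram_scale_left)

lemma represents_Cauchy: "represents k s f \<Longrightarrow> pre.Cauchy_seq s"
  by (simp add: represents_def)

lemma represents_add:
  assumes s: "represents k s f" and t: "represents k t g"
  shows "represents k (\<lambda>n. s n @ t n) (\<lambda>x. f x + g x)"
proof -
  have "\<exists>N. \<forall>m\<ge>N. \<forall>n\<ge>N. hdist (combinations k) (s m @ t m) (s n @ t n) < e" if e: "e > 0" for e
  proof -
    obtain N1 where N1: "\<And>m n. \<lbrakk>m \<ge> N1; n \<ge> N1\<rbrakk> \<Longrightarrow> hdist (combinations k) (s m) (s n) < e / 2"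
      using pre.Cauchy_seqD[OF represents_Cauchy[OF s], of "e / 2"] e by auto
    obtain N2 where N2: "\<And>m n. \<lbrakk>m \<ge> N2; n \<ge> N2\<rbrakk> \<Longrightarrow> hdist (combinations k) (t m) (t n) < e / 2"
      using pre.Cauchy_seqD[OF represents_Cauchy[OF t], of "e / 2"] e by auto
    have "hdist (combinations k) (s m @ t m) (s n @ t n) < e" if "m \<ge> max N1 N2" "n \<ge> max N1 N2" for m n
      using pre.dist_add[of "s m" "t m" "s n" "t n"] N1[of m n] N2[of m n] that by simp
    then show ?thesis by blast
  qed
  then show ?thesis
    using s t by (auto simp: represents_def pre.Cauchy_seq_def gram_append_left intro!: tendsto_add)
qed

lemma represents_scale:
  assumes s: "represents k s f"
  shows "represents k (\<lambda>n. hscale (combinations k) a (s n)) (\<lambda>x. a * f x)"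
proof -
  have "\<exists>N. \<forall>m\<ge>N. \<forall>n\<ge>N. hdist (combinations k) (hscale (combinations k) a (s m))
      (hscale (combinations k) a (s n)) < e" if e: "e > 0" for e
  proof -
    have pos: "e / (cmod a + 1) > 0" using e by (simp add: add_nonneg_pos)
    obtain N where N: "\<And>m n. \<lbrakk>m \<ge> N; n \<ge> N\<rbrakk> \<Longrightarrow> hdist (combinations k) (s m) (s n) < e / (cmod a + 1)"
      using pre.Cauchy_seqD[OF represents_Cauchy[OF s] pos] by auto
    have "hdist (combinations k) (hscale (combinations k) a (s m)) (hscale (combinations k) a (s n)) < e"
      if "m \<ge> N" "n \<ge> N" for m n
    proof -
      have "hdist (combinations k) (hscale (combinations k) a (s m)) (hscale (combinations k) a (s n))
          = cmod a * hdist (combinations k) (s m) (s n)" by (rule pre.dist_scale) simp_all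
      also have "\<dots> \<le> (cmod a + 1) * hdist (combinations k) (s m) (s n)"
        by (intro mult_right_mono) (simp_all add: pre.dist_nonneg)
      also have "\<dots> < (cmod a + 1) * (e / (cmod a + 1))"
        using N[OF that] by (intro mult_strict_left_mono) (simp_all add: add_nonneg_pos)
      also have "\<dots> = e" using norm_ge_zero[of a] by (simp add: add_nonneg_eq_0_iff)
      finally show ?thesis .
    qed
    then show ?thesis by blast
  qed
  then show ?thesis
    using s by (auto simp: represents_def pre.Cauchy_seq_def gram_scale_left intro!: tendsto_mult)
qed

lemma represents_diff:
  assumes "represents k s f" "represents k t g"
  shows "represents k (\<lambda>n. pre.diff (s n) (t n)) (\<lambda>x. f x - g x)"
  using represents_add[OF assms(1) represents_scale[OF assms(2), of "-1"]] by simp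

lemma represents_const: "represents k (\<lambda>_. l) (\<lambda>y. gram k l [(1, y)])"
  using pre.dist_square[of l l] by (auto simp: represents_def pre.Cauchy_seq_def)

lemma represents_gram_tendsto:
  assumes "represents k s f"
  shows "(\<lambda>n. gram k (s n) m) \<longlonglongrightarrow> (\<Sum>(b, y)\<leftarrow>m. cnj b * f y)"
proof (induction m)
  case Nil
  then show ?case by (simp add: gram_Nil_right)
next
  case (Cons p m)
  obtain b y where "p = (b, y)" by force
  then show ?case
    using assms Cons unfolding represents_def
    by (auto simp: gram_Cons_right[of k _ b y m] intro!: tendsto_add tendsto_mult)
qed

text \<open>
  A sequence that represents \<open>0\<close> becomes orthogonal to every fixed combination, in particular to
  each of its own terms.  This makes the seminorm a function of what is represented.
\<close>

lemma represents_zero: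
  assumes "represents k s (\<lambda>_. 0)"
  shows "(\<lambda>n. hnorm (combinations k) (s n)) \<longlonglongrightarrow> 0"
  using pre.Cauchy_seq_weakly_null[OF represents_Cauchy[OF assms]]
    represents_gram_tendsto[OF assms] by (simp add: split_def)

lemma represents_unique:
  assumes s: "represents k s f" and s': "represents k s' f" and t: "pre.Cauchy_seq t"
  shows "(\<lambda>n. gram k (s n) (t n) - gram k (s' n) (t n)) \<longlonglongrightarrow> 0"
proof -
  obtain B where B: "B > 0" "\<And>n. hnorm (combinations k) (t n) \<le> B"
    using pre.Cauchy_seq_bounded[OF t] by blast
  have "(\<lambda>n. hdist (combinations k) (s n) (s' n)) \<longlonglongrightarrow> 0"
    using represents_zero[of "\<lambda>n. pre.diff (s n) (s' n)"] represents_diff[OF s s']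
    by (simp add: pre.dist_eq)
  then have *: "(\<lambda>n. hdist (combinations k) (s n) (s' n) * B) \<longlonglongrightarrow> 0"
    using tendsto_mult_left_zero by blast
  have "cmod (gram k (s n) (t n) - gram k (s' n) (t n)) \<le> hdist (combinations k) (s n) (s' n) * B" for n
    using pre.inner_diff_bound(1)[of "s n" "s' n" "t n"]
      mult_left_mono[OF B(2)[of n] pre.dist_nonneg[of "s n" "s' n"]] by simp
  then show ?thesis by (intro Lim_null_comparison[OF _ *]) auto
qed

text \<open>
  The inner product does not depend on the chosen representing sequences, so its properties are
  those of the Gram form, in the limit.
\<close>

lemma rkhs_inner_tendsto:
  assumes s: "represents k s f" and t: "represents k t g"
  shows "(\<lambda>n. gram k (s n) (t n)) \<longlonglongrightarrow> hinner (rkhs k) f g"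
proof -
  define s' where "s' = (SOME s. represents k s f)"
  define t' where "t' = (SOME t. represents k t g)"
  have s': "represents k s' f" unfolding s'_def by (rule someI[of _ s]) (rule s)
  have t': "represents k t' g" unfolding t'_def by (rule someI[of _ t]) (rule t)
  have "convergent (\<lambda>n. gram k (s' n) (t' n))"
    using pre.convergent_inner[OF represents_Cauchy[OF s'] represents_Cauchy[OF t']] by simp
  then have 1: "(\<lambda>n. gram k (s' n) (t' n)) \<longlonglongrightarrow> hinner (rkhs k) f g"
    by (simp add: rkhs_def s'_def t'_def convergent_LIMSEQ_iff)
  have 2: "(\<lambda>n. gram k (s n) (t n) - gram k (s' n) (t n)) \<longlonglongrightarrow> 0"
    by (rule represents_unique[OF s s' represents_Cauchy[OF t]])
  have "(\<lambda>n. cnj (gram k (t n) (s' n) - gram k (t' n) (s' n))) \<longlonglongrightarrow> cnj 0"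
    by (intro tendsto_cnj represents_unique[OF t t' represents_Cauchy[OF s']])
  then have 3: "(\<lambda>n. gram k (s' n) (t n) - gram k (s' n) (t' n)) \<longlonglongrightarrow> 0"
    by (simp flip: gram_hermitian)
  show ?thesis using tendsto_add[OF tendsto_add[OF 2 3] 1] by simp
qed

lemma rkhs_innerI:
  assumes "represents k s f" "represents k t g" "(\<lambda>n. gram k (s n) (t n)) \<longlonglongrightarrow> c"
  shows "hinner (rkhs k) f g = c"
  using rkhs_inner_tendsto[OF assms(1,2)] assms(3) by (rule LIMSEQ_unique)

lemma reproducing:
  assumes "f \<in> hcarrier (rkhs k)"
  shows "hinner (rkhs k) f (\<lambda>y. gram k [(1, x)] [(1, y)]) = f x"
  using assms rkhs_innerI[OF _ represents_const[of "[(1, x)]"]] by (auto simp: rkhs_carrier represents_def)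

sublocale rkhs: complex_inner_space "rkhs k"
proof
  fix f g assume f: "f \<in> hcarrier (rkhs k)" and g: "g \<in> hcarrier (rkhs k)"
  then show "hadd (rkhs k) f g \<in> hcarrier (rkhs k)"
    by (auto simp: rkhs_carrier intro: represents_add)
  obtain s t where st: "represents k s f" "represents k t g"
    using f g by (auto simp: rkhs_carrier)
  show "hinner (rkhs k) g f = cnj (hinner (rkhs k) f g)"
    using tendsto_cnj[OF rkhs_inner_tendsto[OF st]]
    by (intro rkhs_innerI[OF st(2,1)]) (simp flip: gram_hermitian)
  show "hinner (rkhs k) (hscale (rkhs k) a f) g = a * hinner (rkhs k) f g" for a
    using tendsto_mult_left[OF rkhs_inner_tendsto[OF st], of a]
    by (auto intro!: rkhs_innerI[OF represents_scale[OF st(1)] st(2)] simp: gram_scale_left)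
next
  fix f a assume "f \<in> hcarrier (rkhs k)"
  then show "hscale (rkhs k) a f \<in> hcarrier (rkhs k)"
    using represents_scale by (auto simp: rkhs_carrier)
next
  fix f g h assume "f \<in> hcarrier (rkhs k)" "g \<in> hcarrier (rkhs k)" "h \<in> hcarrier (rkhs k)"
  then obtain s t u where st: "represents k s f" "represents k t g" "represents k u h"
    by (auto simp: rkhs_carrier)
  show "hinner (rkhs k) (hadd (rkhs k) f g) h = hinner (rkhs k) f h + hinner (rkhs k) g h"
    using tendsto_add[OF rkhs_inner_tendsto[OF st(1,3)] rkhs_inner_tendsto[OF st(2,3)]]
    by (auto intro!: rkhs_innerI[OF represents_add[OF st(1,2)] st(3)] simp: gram_append_left)
next
  fix f assume "f \<in> hcarrier (rkhs k)"
  then obtain s where s: "represents k s f" by (auto simp: rkhs_carrier)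
  have "(\<lambda>n. Re (gram k (s n) (s n))) \<longlonglongrightarrow> Re (hinner (rkhs k) f f)"
    by (intro tendsto_Re rkhs_inner_tendsto s)
  then show "0 \<le> Re (hinner (rkhs k) f f)"
    using pre.inner_nonneg by (intro LIMSEQ_le_const[where X = "\<lambda>n. Re (gram k (s n) (s n))"]) auto
next
  show "hzero (rkhs k) \<in> hcarrier (rkhs k)"
    using represents_const[of "[]"] by (auto simp: rkhs_carrier gram_def)
next
  fix f assume f: "f \<in> hcarrier (rkhs k)" and 0: "hinner (rkhs k) f f = 0"
  obtain s where s: "represents k s f" using f by (auto simp: rkhs_carrier)
  have "(\<lambda>n. sqrt (Re (gram k (s n) (s n)))) \<longlonglongrightarrow> sqrt (Re 0)"
    using rkhs_inner_tendsto[OF s s] unfolding 0 by (intro tendsto_intros)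
  then have norm: "(\<lambda>n. hnorm (combinations k) (s n)) \<longlonglongrightarrow> 0" by (simp add: hnorm_def)
  have "f y = 0" for y
  proof -
    have bound: "(\<lambda>n. hnorm (combinations k) (s n) * hnorm (combinations k) [(1, y)]) \<longlonglongrightarrow> 0"
      using norm tendsto_mult_left_zero by blast
    have "cmod (gram k (s n) [(1, y)])
        \<le> hnorm (combinations k) (s n) * hnorm (combinations k) [(1, y)]" for n
      using pre.Cauchy_Schwarz[of "s n" "[(1, y)]"] by simp
    then have "(\<lambda>n. gram k (s n) [(1, y)]) \<longlonglongrightarrow> 0"
      by (intro Lim_null_comparison[OF _ bound]) auto
    then show "f y = 0" using s LIMSEQ_unique unfolding represents_def by blast
  qed
  then show "f = hzero (rkhs k)" by auto
qed (auto simp: algebra_simps)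

lemma rkhs_dist_tendsto:
  assumes "represents k s f" "represents k t g"
  shows "(\<lambda>n. hdist (combinations k) (s n) (t n)) \<longlonglongrightarrow> hdist (rkhs k) f g"
proof -
  have d: "represents k (\<lambda>n. pre.diff (s n) (t n)) (\<lambda>x. f x - g x)"
    by (rule represents_diff[OF assms])
  have "(\<lambda>n. hnorm (combinations k) (pre.diff (s n) (t n))) \<longlonglongrightarrow> hnorm (rkhs k) (\<lambda>x. f x - g x)"
    unfolding hnorm_def combinations_simps(5)
    by (intro tendsto_real_sqrt tendsto_Re rkhs_inner_tendsto d)
  moreover have "hdist (rkhs k) f g = hnorm (rkhs k) (\<lambda>x. f x - g x)"
    using assms by (subst rkhs.dist_eq) (auto simp: rkhs_carrier)
  ultimately show ?thesis by (simp add: pre.dist_eq)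
qed

lemma rkhs_dist_combinations:
  "hdist (rkhs k) (\<lambda>y. gram k l [(1, y)]) (\<lambda>y. gram k m [(1, y)]) = hdist (combinations k) l m"
  using rkhs_dist_tendsto[OF represents_const represents_const, of l m] by (simp add: LIMSEQ_const_iff)

text \<open>
  The distance from \<open>f\<close> to the \<open>n\<close>-th term is the limit of the distances between terms of the
  sequence, which the Cauchy property makes small.
\<close>

lemma represents_approx:
  assumes s: "represents k s f" and e: "e > 0"
  shows "\<exists>N. \<forall>n\<ge>N. hdist (rkhs k) f (\<lambda>y. gram k (s n) [(1, y)]) \<le> e"
proof -
  obtain N where N: "\<And>m n. \<lbrakk>m \<ge> N; n \<ge> N\<rbrakk> \<Longrightarrow> hdist (combinations k) (s m) (s n) < e"
    using pre.Cauchy_seqD[OF represents_Cauchy[OF s] e] by auto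
  have "hdist (rkhs k) f (\<lambda>y. gram k (s n) [(1, y)]) \<le> e" if "n \<ge> N" for n
    using rkhs_dist_tendsto[OF s represents_const[of "s n"]] N[OF _ that]
    by (intro LIMSEQ_le_const2[where X = "\<lambda>m. hdist (combinations k) (s m) (s n)"])
      (auto intro!: exI[of _ N] less_imp_le)
  then show ?thesis by blast
qed

text \<open>
  Approximating the \<open>n\<close>-th function up to \<open>1 / (n + 1)\<close> by a single combination \<open>l n\<close> yields a
  Cauchy sequence of combinations, and the function that it represents is the limit.
\<close>

lemma rkhs_complete: "Metric_space.mcomplete (hcarrier (rkhs k)) (hdist (rkhs k))"
proof -
  interpret Metric_space "hcarrier (rkhs k)" "hdist (rkhs k)" by (rule rkhs.metric_space)
  let ?F = "\<lambda>l y. gram k l [(1, y)]"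
  have F: "?F l \<in> hcarrier (rkhs k)" for l using represents_const by (auto simp: rkhs_carrier)
  show ?thesis unfolding mcomplete_def
  proof (intro allI impI)
    fix \<sigma> assume \<sigma>: "MCauchy \<sigma>"
    then have c: "\<sigma> n \<in> hcarrier (rkhs k)" for n by (auto simp: MCauchy_def)
    have "\<exists>l. hdist (rkhs k) (\<sigma> n) (?F l) \<le> inverse (real (Suc n))" for n
    proof -
      obtain s where s: "represents k s (\<sigma> n)" using c[of n] by (auto simp: rkhs_carrier)
      show ?thesis using represents_approx[OF s, of "inverse (real (Suc n))"] by auto
    qed
    then obtain l where l: "\<And>n. hdist (rkhs k) (\<sigma> n) (?F (l n)) \<le> inverse (real (Suc n))" by metis
    have small: "\<exists>N. \<forall>n\<ge>N. hdist (rkhs k) (\<sigma> n) (?F (l n)) < e" if e: "e > 0" for e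
    proof -
      obtain N where N: "inverse (real (Suc N)) < e" using reals_Archimedean[OF e] by blast
      have "hdist (rkhs k) (\<sigma> n) (?F (l n)) < e" if "n \<ge> N" for n
      proof -
        have "inverse (real (Suc n)) \<le> inverse (real (Suc N))"
          using that by (intro le_imp_inverse_le) auto
        then show ?thesis using l[of n] N by linarith
      qed
      then show ?thesis by blast
    qed
    have "pre.Cauchy_seq l"
      unfolding pre.Cauchy_seq_def
    proof (intro conjI allI impI)
      fix e :: real assume e: "e > 0"
      obtain N1 where N1: "\<And>m n. \<lbrakk>m \<ge> N1; n \<ge> N1\<rbrakk> \<Longrightarrow> hdist (rkhs k) (\<sigma> m) (\<sigma> n) < e / 3"
        using \<sigma> e unfolding MCauchy_def by (meson divide_pos_pos zero_less_numeral)
      obtain N2 where N2: "\<And>n. n \<ge> N2 \<Longrightarrow> hdist (rkhs k) (\<sigma> n) (?F (l n)) < e / 3"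
        using small[of "e / 3"] e by auto
      have "hdist (combinations k) (l m) (l n) < e" if "m \<ge> max N1 N2" "n \<ge> max N1 N2" for m n
      proof -
        have "hdist (rkhs k) (?F (l m)) (?F (l n))
            \<le> hdist (rkhs k) (?F (l m)) (\<sigma> m) + hdist (rkhs k) (\<sigma> m) (?F (l n))"
          by (intro triangle F c)
        moreover have "hdist (rkhs k) (\<sigma> m) (?F (l n))
            \<le> hdist (rkhs k) (\<sigma> m) (\<sigma> n) + hdist (rkhs k) (\<sigma> n) (?F (l n))"
          by (intro triangle F c)
        moreover have "hdist (rkhs k) (?F (l m)) (\<sigma> m) = hdist (rkhs k) (\<sigma> m) (?F (l m))"
          by (rule commute)
        ultimately show ?thesis
          using N1[of m n] N2[of m] N2[of n] that unfolding rkhs_dist_combinations by simp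
      qed
      then show "\<exists>N. \<forall>m\<ge>N. \<forall>n\<ge>N. hdist (combinations k) (l m) (l n) < e" by blast
    qed simp
    moreover define f where "f y = lim (\<lambda>n. gram k (l n) [(1, y)])" for y
    ultimately have f: "represents k l f"
      using pre.convergent_inner[of l "\<lambda>_. [(1, _)]"] represents_Cauchy[OF represents_const]
      by (auto simp: represents_def convergent_LIMSEQ_iff)
    then have fc: "f \<in> hcarrier (rkhs k)" by (auto simp: rkhs_carrier)
    have "limitin mtopology \<sigma> f sequentially"
      unfolding limitin_metric
    proof (intro conjI allI impI fc)
      fix e :: real assume e: "e > 0"
      obtain N1 where N1: "\<And>n. n \<ge> N1 \<Longrightarrow> hdist (rkhs k) f (?F (l n)) \<le> e / 2"
        using represents_approx[OF f, of "e / 2"] e by auto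
      obtain N2 where N2: "\<And>n. n \<ge> N2 \<Longrightarrow> hdist (rkhs k) (\<sigma> n) (?F (l n)) < e / 2"
        using small[of "e / 2"] e by auto
      have "hdist (rkhs k) (\<sigma> n) f < e" if "n \<ge> max N1 N2" for n
        using triangle[OF c[of n] F[of "l n"] fc] commute[of f "?F (l n)"] N1[of n] N2[of n] that
        by simp
      then show "\<forall>\<^sub>F n in sequentially. \<sigma> n \<in> hcarrier (rkhs k) \<and> hdist (rkhs k) (\<sigma> n) f < e"
        using c by (auto simp: eventually_sequentially intro!: exI[of _ "max N1 N2"])
    qed
    then show "\<exists>x. limitin mtopology \<sigma> x sequentially" by blast
  qed
qed

lemma rkhs_hilbert: "complex_hilbert_space (rkhs k)"
  by unfold_locales
    ((rule rkhs_complete rkhs.zero_closed rkhs.add_closed rkhs.scale_closed rkhs.add_assoc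
      rkhs.add_commute rkhs.add_zero rkhs.add_neg rkhs.scale_one rkhs.scale_scale rkhs.scale_add_left
      rkhs.scale_add_right rkhs.inner_add rkhs.inner_scale rkhs.inner_commute rkhs.inner_nonneg
      rkhs.inner_definite; assumption)+)

lemma kernel_section: "(\<lambda>y. k (x, y)) \<in> hcarrier (rkhs k)"
  using represents_const[of "[(1, x)]"] by (auto simp: rkhs_carrier gram_def)

lemma kernel_factors: "k (x, y) = hinner (rkhs k) (\<lambda>z. k (x, z)) (\<lambda>z. k (y, z))"
  using reproducing[OF kernel_section, of x y] by (simp add: gram_def)

lemma kernel_section_dist:
  "(hdist (rkhs k) (\<lambda>z. k (x, z)) (\<lambda>z. k (y, z)))\<^sup>2 = Re (k (x, x) - k (x, y) - k (y, x) + k (y, y))"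
  by (simp add: rkhs.dist_square kernel_section flip: kernel_factors)

end


section \<open>Positivity of a continuous symbol\<close>

lemma radon_measure_open: "radon_measure M \<Longrightarrow> open U \<Longrightarrow> U \<in> sets M"
  using borel_open unfolding radon_measure_def by blast

lemma radon_measure_continuous:
  fixes g :: "'a::t2_space \<Rightarrow> complex"
  assumes "radon_measure M" "continuous_on UNIV g"
  shows "g \<in> borel_measurable M"
proof (rule borel_measurableI)
  fix S :: "complex set" assume "open S"
  then have "open (g -` S)" using assms(2) by (simp add: continuous_on_open_vimage)
  then show "g -` S \<inter> space M \<in> sets M"
    using assms(1) radon_measure_open by (auto simp: radon_measure_def)
qed

lemma open_set_prod_nbhd:
  fixes \<phi> :: "'a::topological_space \<times> 'b::topological_space \<Rightarrow> 'c::topological_space"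
  assumes "continuous_on UNIV \<phi>" "open S" "\<phi> (x, y) \<in> S"
  shows "\<exists>A B. open A \<and> open B \<and> x \<in> A \<and> y \<in> B \<and> (\<forall>x'\<in>A. \<forall>y'\<in>B. \<phi> (x', y') \<in> S)"
proof -
  have "open (\<phi> -` S)" using assms by (simp add: continuous_on_open_vimage)
  then obtain A B where "open A" "open B" "(x, y) \<in> A \<times> B" "A \<times> B \<subseteq> \<phi> -` S"
    using assms(3) by (elim open_prod_elim[of _ "(x, y)"]) auto
  then show ?thesis by (intro exI[of _ A] exI[of _ B]) auto
qed

text \<open>
  The exceptional null set would contain an open rectangle, and these have positive measure.
\<close>

lemma essentially_bounded_imp_bounded:
  fixes \<phi> :: "'a::t2_space \<times> 'a \<Rightarrow> complex"
  assumes radon: "radon_measure M" and sf: "sigma_finite_measure M" and supp: "full_support M"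
    and bdd: "essentially_bounded (square_measure M) \<phi>" and cont: "continuous_on UNIV \<phi>"
  shows "\<exists>C. \<forall>z. cmod (\<phi> z) \<le> C"
proof -
  interpret sigma_finite_measure M by (rule sf)
  obtain C where "AE z in square_measure M. cmod (\<phi> z) \<le> C"
    using bdd by (auto simp: essentially_bounded_def)
  then obtain N where N: "N \<in> null_sets (square_measure M)"
      "{z \<in> space (square_measure M). \<not> cmod (\<phi> z) \<le> C} \<subseteq> N"
    by (auto simp: eventually_ae_filter)
  have "cmod (\<phi> (x, y)) \<le> C" for x y
  proof (rule ccontr)
    assume "\<not> cmod (\<phi> (x, y)) \<le> C"
    then have "\<phi> (x, y) \<in> {z. C < cmod z}" by simp
    moreover have "open {z. C < cmod z}" by (intro open_Collect_less continuous_intros)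
    ultimately obtain A B where AB: "open A" "open B" "x \<in> A" "y \<in> B"
        "\<forall>x'\<in>A. \<forall>y'\<in>B. \<phi> (x', y') \<in> {z. C < cmod z}"
      using open_set_prod_nbhd[OF cont, of "{z. C < cmod z}" x y] by blast
    have sets: "A \<in> sets M" "B \<in> sets M" using AB radon_measure_open[OF radon] by auto
    have "space (square_measure M) = UNIV"
      using radon by (auto simp: radon_measure_def space_pair_measure)
    then have "A \<times> B \<subseteq> N" using N(2) AB(5) by (force simp: not_le)
    moreover obtain N' where N': "N' \<in> null_sets (M \<Otimes>\<^sub>M M)" "N \<subseteq> N'"
      using N(1) by (auto simp: null_sets_completion_iff2)
    ultimately have "emeasure (M \<Otimes>\<^sub>M M) (A \<times> B) \<le> emeasure (M \<Otimes>\<^sub>M M) N'"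
      by (intro emeasure_mono) auto
    then have "emeasure M A * emeasure M B = 0"
      using N' sets by (auto simp: emeasure_pair_measure_Times)
    moreover have "emeasure M A > 0" "emeasure M B > 0"
      using supp AB by (auto simp: full_support_def)
    ultimately show False by auto
  qed
  then show ?thesis by auto
qed

lemma weighted_average:
  fixes w :: "'a \<Rightarrow> real" and g :: "'a \<Rightarrow> complex"
  assumes w: "integrable M w" "\<And>x. 0 \<le> w x" "(LINT x|M. w x) = 1"
    and g: "g \<in> borel_measurable M" and near: "AE x in M. w x \<noteq> 0 \<longrightarrow> cmod (g x - c) \<le> e"
  shows "integrable M (\<lambda>x. of_real (w x) * g x)"
    and "cmod ((LINT x|M. of_real (w x) * g x) - c) \<le> e"
proof -
  let ?h = "\<lambda>x. of_real (w x) * (g x - c)"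
  have [measurable]: "w \<in> borel_measurable M" "g \<in> borel_measurable M" using w g by auto
  have bound: "AE x in M. norm (?h x) \<le> e * w x"
    using near by eventually_elim (auto simp: norm_mult w(2) mult.commute[of e] intro: mult_left_mono)
  have int: "integrable M (\<lambda>x. e * w x)" using w by simp
  have h: "integrable M ?h"
    by (rule Bochner_Integration.integrable_bound[OF int]) (use bound in auto)
  have c: "integrable M (\<lambda>x. of_real (w x) * c)"
    by (intro integrable_mult_left integrable_of_real w(1))
  have split: "(\<lambda>x. of_real (w x) * g x) = (\<lambda>x. ?h x + of_real (w x) * c)"
    by (auto simp: algebra_simps)
  show "integrable M (\<lambda>x. of_real (w x) * g x)"
    unfolding split using h c by simp
  have "(LINT x|M. of_real (w x) * g x) = (LINT x|M. ?h x) + c"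
    unfolding split using h c w(3) by simp
  then have "cmod ((LINT x|M. of_real (w x) * g x) - c) = norm (LINT x|M. ?h x)" by simp
  also have "\<dots> \<le> (LINT x|M. e * w x)"
    by (rule order_trans[OF integral_norm_bound integral_mono_AE]) (use h int bound in auto)
  finally show "cmod ((LINT x|M. of_real (w x) * g x) - c) \<le> e" using w(3) by simp
qed

lemma small_neighbourhoods:
  fixes M :: "'a::t2_space measure" and x :: "nat \<Rightarrow> 'a" and n :: nat
  assumes lc: "locally_compact_space (euclidean :: 'a topology)" and radon: "radon_measure M"
    and cont: "continuous_on UNIV \<phi>" and e: "e > 0"
  obtains U where "\<And>i. i < n \<Longrightarrow> open (U i)" "\<And>i. i < n \<Longrightarrow> x i \<in> U i"
    "\<And>i. i < n \<Longrightarrow> emeasure M (U i) < \<infinity>"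
    "\<And>i j y z. \<lbrakk>i < n; j < n; y \<in> U i; z \<in> U j\<rbrakk> \<Longrightarrow> cmod (\<phi> (y, z) - \<phi> (x i, x j)) \<le> e"
proof -
  have "\<exists>V. open V \<and> x i \<in> V \<and> emeasure M V < \<infinity>" for i
  proof -
    have "\<exists>V K. open V \<and> compact K \<and> x i \<in> V \<and> V \<subseteq> K"
      using lc by (simp add: locally_compact_space_def)
    then obtain V K where V: "open V" "compact K" "x i \<in> V" "V \<subseteq> K" by blast
    have "emeasure M V \<le> emeasure M K"
      using V radon borel_closed[OF compact_imp_closed[OF V(2)]]
      by (intro emeasure_mono) (auto simp: radon_measure_def)
    also have "\<dots> < \<infinity>" using radon V by (auto simp: radon_measure_def)
    finally show ?thesis using V by blast
  qed
  then obtain V where V: "\<And>i. open (V i)" "\<And>i. x i \<in> V i" "\<And>i. emeasure M (V i) < \<infinity>" by metis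
  define P where "P i j A B \<longleftrightarrow> open A \<and> open B \<and> x i \<in> A \<and> x j \<in> B \<and>
      (\<forall>y\<in>A. \<forall>z\<in>B. \<phi> (y, z) \<in> ball (\<phi> (x i, x j)) e)" for i j A B
  have "\<exists>A B. P i j A B" for i j
    unfolding P_def by (rule open_set_prod_nbhd[OF cont open_ball]) (simp add: e)
  then obtain A B where P: "\<And>i j. P i j (A i j) (B i j)" by metis
  have AB: "open (A i j)" "open (B i j)" "x i \<in> A i j" "x j \<in> B i j"
      "\<And>y z. y \<in> A i j \<Longrightarrow> z \<in> B i j \<Longrightarrow> \<phi> (y, z) \<in> ball (\<phi> (x i, x j)) e" for i j
    using P[of i j] unfolding P_def by blast+
  define U where "U i = V i \<inter> (\<Inter>j<n. A i j \<inter> B j i)" for i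
  show ?thesis
  proof
    fix i assume "i < n"
    show op: "open (U i)" unfolding U_def using V AB by (intro open_Int open_INT) auto
    show "x i \<in> U i" using V AB by (auto simp: U_def)
    have "emeasure M (U i) \<le> emeasure M (V i)"
      using radon_measure_open[OF radon V(1)] by (intro emeasure_mono) (auto simp: U_def)
    then show "emeasure M (U i) < \<infinity>" using V(3)[of i] by (rule le_less_trans)
  next
    fix i j y z assume "i < n" "j < n" "y \<in> U i" "z \<in> U j"
    then have "y \<in> A i j" "z \<in> B i j" by (auto simp: U_def)
    then show "cmod (\<phi> (y, z) - \<phi> (x i, x j)) \<le> e"
      using AB(5)[of y i j z] by (simp add: dist_norm norm_minus_commute)
  qed
qed

text \<open>
  The indicator of \<open>A \<times> A\<close> is the kernel of a positive operator of rank one.  It is compact, so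
  its image is given by the product of the kernels.
\<close>

lemma multiplier_on_square:
  assumes sf: "sigma_finite_measure M" and mult: "measurable_schur_multiplier M \<phi> \<Phi>"
    and pos: "positive_map (L2 M) \<Phi>" and A: "A \<in> sets M" "emeasure M A < \<infinity>"
  shows "positive_op (L2 M) (kernel_op M (\<lambda>z. \<phi> z * indicator (A \<times> A) z))"
proof -
  interpret sigma_finite_measure M by (rule sf)
  interpret complex_inner_space "L2 M" by (rule L2_inner_product_space)
  obtain \<Psi> where \<Psi>: "schur_map_on_compacts M \<phi> \<Psi>" "\<And>T. T \<in> compact_ops (L2 M) \<Longrightarrow> \<Phi> T = \<Psi> T"
    using mult by (auto simp: measurable_schur_multiplier_def)
  note e = L2_class_carrier[OF square_integrable_indicator[OF A]]
  have "square_integrable (square_measure M) (indicator (A \<times> A))"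
    using A by (intro square_integrable_indicator)
      (auto simp: emeasure_pair_measure_Times ennreal_mult_less_top)
  then have "\<Phi> (kernel_op M (indicator (A \<times> A))) = kernel_op M (\<lambda>z. \<phi> z * indicator (A \<times> A) z)"
    using \<Psi> rank_one_compact[OF e] unfolding kernel_op_indicator_square[OF A, symmetric]
    by (simp add: schur_map_on_compacts_def)
  moreover have "positive_op (L2 M) (\<Phi> (kernel_op M (indicator (A \<times> A))))"
    using pos rank_one_positive[OF e] unfolding kernel_op_indicator_square[OF A, symmetric]
    by (simp add: positive_map_def)
  ultimately show ?thesis by simp
qed

lemma square_integrable_sum:
  "(\<And>i. i \<in> I \<Longrightarrow> square_integrable M (f i)) \<Longrightarrow> square_integrable M (\<lambda>x. \<Sum>i\<in>I. f i x)"
  by (induction I rule: infinite_finite_induct) (auto simp: square_integrable_0 square_integrable_add)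

text \<open>
  The operator is tested on a combination of normalised indicators of small neighbourhoods of the
  points, a substitute for the point masses.  Both integrals are averages of functions that are
  almost constant, so they are estimated one after the other and need not be exchanged.
\<close>

lemma gram_approx:
  fixes M :: "'a::t2_space measure" and n :: nat
  assumes lc: "locally_compact_space (euclidean :: 'a topology)" and radon: "radon_measure M"
    and sf: "sigma_finite_measure M" and supp: "full_support M"
    and mult: "measurable_schur_multiplier M \<phi> \<Phi>" and pos: "positive_map (L2 M) \<Phi>"
    and cont: "continuous_on UNIV \<phi>" and e: "e > 0"
  shows "\<exists>P\<in>\<real>\<^sub>\<ge>\<^sub>0. cmod (P - (\<Sum>i<n. \<Sum>j<n. a i * cnj (a j) * \<phi> (x i, x j))) \<le> e * (\<Sum>i<n. cmod (a i))\<^sup>2"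
proof -
  obtain U where U: "\<And>i. i < n \<Longrightarrow> open (U i)" "\<And>i. i < n \<Longrightarrow> x i \<in> U i"
      "\<And>i. i < n \<Longrightarrow> emeasure M (U i) < \<infinity>"
      "\<And>i j y z. \<lbrakk>i < n; j < n; y \<in> U i; z \<in> U j\<rbrakk> \<Longrightarrow> cmod (\<phi> (y, z) - \<phi> (x i, x j)) \<le> e"
    using small_neighbourhoods[OF lc radon cont e, of n x] by blast
  define S where "S = (\<Sum>i<n. cmod (a i))"
  define A where "A = (\<Union>i<n. U i)"
  define w where "w i y = indicator (U i) y / measure M (U i)" for i y
  \<comment> \<open>In the quadratic form the outer copy of \<open>u\<close> is conjugated again, which gives \<open>a i * cnj (a j)\<close>.\<close>
  define u where "u y = (\<Sum>i<n. cnj (a i) * of_real (w i y))" for y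
  define K where "K = kernel_op M (\<lambda>z. \<phi> z * indicator (A \<times> A) z)"
  have sets: "U i \<in> sets M" if "i < n" for i using U(1)[OF that] by (rule radon_measure_open[OF radon])
  have measure: "measure M (U i) > 0" if "i < n" for i
    using U(1-3)[OF that] supp by (auto simp: measure_def full_support_def enn2real_positive_iff)
  have w_nonneg: "0 \<le> w i y" for i y by (simp add: w_def)
  have w_eq: "w i = (\<lambda>y. indicator (U i) y / measure M (U i))" for i
    by (simp add: w_def fun_eq_iff)
  have w_int: "integrable M (w i)" "(LINT y|M. w i y) = 1" if "i < n" for i
    using sets[OF that] measure[OF that] U(3)[OF that] by (simp_all add: w_eq)
  have w_supp: "y \<in> U i" if "w i y \<noteq> 0" for i y
    using that by (auto simp: w_def indicator_def split: if_splits)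
  have A: "A \<in> sets M" "emeasure M A < \<infinity>"
  proof -
    show "A \<in> sets M" using sets by (auto simp: A_def)
    have "emeasure M A \<le> (\<Sum>i<n. emeasure M (U i))"
      unfolding A_def using sets by (intro emeasure_subadditive_finite) auto
    also have "\<dots> < \<infinity>" using U(3) by simp
    finally show "emeasure M A < \<infinity>" .
  qed
  have u_sq: "square_integrable M u"
  proof -
    have "square_integrable M (\<lambda>y. (cnj (a i) / of_real (measure M (U i))) * indicator (U i) y)" if "i < n" for i
      using sets[OF that] U(3)[OF that] by (intro square_integrable_scale square_integrable_indicator)
    moreover have "(\<lambda>y. cnj (a i) * of_real (w i y))
        = (\<lambda>y. (cnj (a i) / of_real (measure M (U i))) * indicator (U i) y)" for i
      by (auto simp: w_def indicator_def)
    ultimately show ?thesis unfolding u_def by (intro square_integrable_sum) simp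
  qed
  have u_supp: "u y = 0" if "y \<notin> A" for y
    using that w_supp unfolding u_def A_def by (intro sum.neutral) fastforce
  have slice: "(\<lambda>y. \<phi> (x', y)) \<in> borel_measurable M" for x'
    by (intro radon_measure_continuous[OF radon] continuous_on_compose2[OF cont] continuous_intros) auto

  define h where "h x' = (LINT y|M. \<phi> (x', y) * indicator (A \<times> A) (x', y) * u y)" for x'
  have "(\<lambda>y. \<phi> (x', y) * indicator (A \<times> A) (x', y)) \<in> borel_measurable M" for x'
    using slice[of x'] A(1) by (cases "x' \<in> A") (simp_all add: indicator_times)
  then have Ku: "K (L2_class M u) = L2_class M h"
    unfolding K_def h_def using u_sq by (simp add: kernel_op_L2_class)
  have Kpos: "positive_op (L2 M) K"
    unfolding K_def by (rule multiplier_on_square[OF sf mult pos A])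
  then have "L2_class M h \<in> hcarrier (L2 M)"
    unfolding positive_op_def bounded_ops_def Ku[symmetric]
    using L2_class_carrier[OF u_sq] by auto
  \<comment> \<open>Measurability of \<open>h\<close> is not clear; \<open>r\<close> replaces it in the outer integral.\<close>
  then obtain r where r: "square_integrable M r" "AE y in M. r y = h y"
    using L2_rep by blast
  have "K (L2_class M u) = L2_class M r"
    unfolding Ku using r(2) by (intro L2_class_eqI) auto
  then have "(LINT y|M. r y * cnj (u y)) \<in> \<real>\<^sub>\<ge>\<^sub>0"
    using Kpos L2_class_carrier[OF u_sq] L2_inner[OF r(1) u_sq] by (auto simp: positive_op_def)
  moreover have "cmod ((LINT y|M. r y * cnj (u y)) - (\<Sum>i<n. \<Sum>j<n. a i * cnj (a j) * \<phi> (x i, x j)))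
      \<le> e * S\<^sup>2"
  proof -
    define c where "c i = (\<Sum>j<n. cnj (a j) * \<phi> (x i, x j))" for i
    have h_near: "cmod (h y - c i) \<le> e * S" if i: "i < n" and y: "y \<in> U i" for i y
    proof -
      let ?I = "\<lambda>j. LINT z|M. of_real (w j z) * \<phi> (y, z)"
      have near: "integrable M (\<lambda>z. of_real (w j z) * \<phi> (y, z))"
          "cmod (?I j - \<phi> (x i, x j)) \<le> e" if j: "j < n" for j
      proof -
        have "AE z in M. w j z \<noteq> 0 \<longrightarrow> cmod (\<phi> (y, z) - \<phi> (x i, x j)) \<le> e"
          using U(4)[OF i j y] w_supp by blast
        then show "integrable M (\<lambda>z. of_real (w j z) * \<phi> (y, z))" "cmod (?I j - \<phi> (x i, x j)) \<le> e"
          using w_int[OF j] w_nonneg slice by (intro weighted_average; blast)+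
      qed
      have "y \<in> A" using i y by (auto simp: A_def)
      then have "h y = (LINT z|M. \<phi> (y, z) * u z)"
        unfolding h_def using u_supp
        by (intro Bochner_Integration.integral_cong) (auto simp: indicator_def)
      also have "\<dots> = (LINT z|M. (\<Sum>j<n. cnj (a j) * (of_real (w j z) * \<phi> (y, z))))"
        by (simp add: u_def sum_distrib_left mult_ac)
      also have "\<dots> = (\<Sum>j<n. cnj (a j) * ?I j)"
        using near(1) by (subst Bochner_Integration.integral_sum) auto
      finally have "h y - c i = (\<Sum>j<n. cnj (a j) * (?I j - \<phi> (x i, x j)))"
        by (simp add: c_def sum_subtractf algebra_simps)
      also have "cmod \<dots> \<le> (\<Sum>j<n. cmod (a j) * e)"
        using near(2) by (intro sum_norm_le) (simp add: norm_mult mult_left_mono)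
      also have "\<dots> = e * S" by (simp add: S_def sum_distrib_left mult.commute)
      finally show ?thesis .
    qed
    let ?J = "\<lambda>i. LINT y|M. of_real (w i y) * r y"
    have near: "integrable M (\<lambda>y. of_real (w i y) * r y)" "cmod (?J i - c i) \<le> e * S" if i: "i < n" for i
    proof -
      have "AE y in M. w i y \<noteq> 0 \<longrightarrow> cmod (r y - c i) \<le> e * S"
        using r(2) by eventually_elim (use h_near[OF i] w_supp in auto)
      then show "integrable M (\<lambda>y. of_real (w i y) * r y)" "cmod (?J i - c i) \<le> e * S"
        using w_int[OF i] w_nonneg square_integrable_measurable[OF r(1)]
        by (intro weighted_average; blast)+
    qed
    have "(LINT y|M. r y * cnj (u y)) = (LINT y|M. (\<Sum>i<n. a i * (of_real (w i y) * r y)))"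
      by (simp add: u_def sum_distrib_left mult_ac)
    also have "\<dots> = (\<Sum>i<n. a i * ?J i)"
      using near(1) by (subst Bochner_Integration.integral_sum) auto
    finally have "(LINT y|M. r y * cnj (u y)) - (\<Sum>i<n. \<Sum>j<n. a i * cnj (a j) * \<phi> (x i, x j))
        = (\<Sum>i<n. a i * (?J i - c i))"
      by (simp add: c_def sum_subtractf sum_distrib_left algebra_simps)
    also have "cmod \<dots> \<le> (\<Sum>i<n. cmod (a i) * (e * S))"
      using near(2) by (intro sum_norm_le) (simp add: norm_mult mult_left_mono)
    also have "\<dots> = e * S\<^sup>2"
      unfolding sum_distrib_right[symmetric] S_def[symmetric] by (simp add: power2_eq_square)
    finally show ?thesis .
  qed
  ultimately show ?thesis unfolding S_def by blast
qed

lemma positive_symbol_kernel: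
  fixes M :: "'a::t2_space measure"
  assumes "locally_compact_space (euclidean :: 'a topology)" "radon_measure M"
    "sigma_finite_measure M" "full_support M"
    "measurable_schur_multiplier M \<phi> \<Phi>" "positive_map (L2 M) \<Phi>" "continuous_on UNIV \<phi>"
  shows "positive_kernel \<phi>"
proof
  fix l :: "(complex \<times> 'a) list"
  define a where "a i = fst (l ! i)" for i
  define x where "x i = snd (l ! i)" for i
  define s where "s = (\<Sum>i<length l. cmod (a i))\<^sup>2"
  have gram_eq: "gram \<phi> l l = (\<Sum>i<length l. \<Sum>j<length l. a i * cnj (a j) * \<phi> (x i, x j))"
    by (simp add: gram_def split_def sum_list_sum_nth atLeast0LessThan a_def x_def)
  have approx: "\<exists>P\<in>\<real>\<^sub>\<ge>\<^sub>0. cmod (P - gram \<phi> l l) \<le> e * s" if "e > 0" for e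
    unfolding s_def gram_eq by (rule gram_approx[OF assms that])
  have "\<exists>P\<in>\<real>\<^sub>\<ge>\<^sub>0. dist P (gram \<phi> l l) < e" if "e > 0" for e
  proof -
    have s: "s \<ge> 0" by (simp add: s_def)
    then have "e / (s + 1) > 0" using that by simp
    then obtain P where P: "P \<in> \<real>\<^sub>\<ge>\<^sub>0" "cmod (P - gram \<phi> l l) \<le> e / (s + 1) * s"
      using approx by blast
    moreover have "e / (s + 1) * s < e" using that s by (simp add: field_simps)
    ultimately show ?thesis by (auto simp: dist_norm intro!: bexI[of _ P])
  qed
  then show "gram \<phi> l l \<in> \<real>\<^sub>\<ge>\<^sub>0"
    using closed_approachable[OF closed_nonneg_Reals_complex] by blast
qed

theorem mainTheorem6:
  fixes M :: "'a::t2_space measure"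
    and \<phi> :: "'a \<times> 'a \<Rightarrow> complex"
    and \<Phi> :: "(('a \<Rightarrow> complex) set \<Rightarrow> ('a \<Rightarrow> complex) set)
              \<Rightarrow> (('a \<Rightarrow> complex) set \<Rightarrow> ('a \<Rightarrow> complex) set)"
  assumes "locally_compact_space (euclidean :: 'a topology)"
    and "radon_measure M"
    and "sigma_finite_measure M"
    and "full_support M"
    and "measurable_schur_multiplier M \<phi> \<Phi>"
    and "positive_map (L2 M) \<Phi>"
    and "continuous_on UNIV \<phi>"
  shows "\<exists>(H :: ('a \<Rightarrow> complex) hspace) \<alpha>.
           complex_hilbert_space H \<and>
           \<alpha> ` UNIV \<subseteq> hcarrier H \<and>
           (\<exists>C. \<forall>x. hnorm H (\<alpha> x) \<le> C) \<and>
           continuous_map euclidean (htopology H) \<alpha> \<and>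
           (\<forall>x y. \<phi> (x, y) = hinner H (\<alpha> x) (\<alpha> y))"
proof -
  interpret positive_kernel \<phi> by (rule positive_symbol_kernel[OF assms])
  interpret Metric_space "hcarrier (rkhs \<phi>)" "hdist (rkhs \<phi>)" by (rule rkhs.metric_space)
  define \<alpha> where "\<alpha> x = (\<lambda>y. \<phi> (x, y))" for x
  have carrier: "\<alpha> x \<in> hcarrier (rkhs \<phi>)" for x
    unfolding \<alpha>_def by (rule kernel_section)
  have factors: "\<phi> (x, y) = hinner (rkhs \<phi>) (\<alpha> x) (\<alpha> y)" for x y
    unfolding \<alpha>_def by (rule kernel_factors)
  obtain C where C: "\<And>z. cmod (\<phi> z) \<le> C"
    using essentially_bounded_imp_bounded[OF assms(2,3,4) _ assms(7)] assms(5)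
    by (auto simp: measurable_schur_multiplier_def)
  have "hnorm (rkhs \<phi>) (\<alpha> x) \<le> sqrt C" for x
    unfolding hnorm_def factors[symmetric]
    using order_trans[OF complex_Re_le_cmod C[of "(x, x)"]] by simp
  moreover have "continuous_map euclidean (htopology (rkhs \<phi>)) \<alpha>"
    unfolding htopology_def continuous_map_to_metric
  proof (intro ballI allI impI)
    fix x :: 'a and e :: real assume e: "e > 0"
    define d where "d y = Re (\<phi> (x, x) - \<phi> (x, y) - \<phi> (y, x) + \<phi> (y, y))" for y
    have dist: "(hdist (rkhs \<phi>) (\<alpha> x) (\<alpha> y))\<^sup>2 = d y" for y
      unfolding \<alpha>_def d_def by (rule kernel_section_dist)
    have "continuous_on UNIV d"
      unfolding d_def by (intro continuous_intros continuous_on_compose2[OF assms(7)]) auto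
    then have "open {y. d y < e\<^sup>2}" by (intro open_Collect_less) (auto intro: continuous_intros)
    moreover have "d x < e\<^sup>2" using e by (simp add: d_def)
    moreover have "\<alpha> y \<in> mball (\<alpha> x) e" if "d y < e\<^sup>2" for y
      using that e carrier power2_less_imp_less[of "hdist (rkhs \<phi>) (\<alpha> x) (\<alpha> y)" e]
      by (simp add: dist[symmetric])
    ultimately show "\<exists>U. openin euclidean U \<and> x \<in> U \<and> (\<forall>y\<in>U. \<alpha> y \<in> mball (\<alpha> x) e)"
      by (intro exI[of _ "{y. d y < e\<^sup>2}"]) auto
  qed
  ultimately show ?thesis
    using rkhs_hilbert carrier factors by (intro exI[of _ "rkhs \<phi>"] exI[of _ \<alpha>]) blast
qed

end
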